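(* Let $n\ge 2$, let $n_0$ be the product of the distinct prime divisors of $n$, let $k$ be the number of distinct prime divisors of $n$, and let $1=d_1<d_2<\dots<d_{2^k}=n_0$ be the divisors of $n_0$. Let $\Delta(D_n)$ be the generating graph of the dihedral group $D_n$ after removing the isolated vertices. Then the distance spectrum of $\Delta(D_n)$ is $$\begin{pmatrix}-2&-2-\mu(d_2)\frac{\varphi(n)}{\varphi(d_2)}&-2-\mu(d_3)\frac{\varphi(n)}{\varphi(d_3)}&\dots&-2-\mu(d_{2^k})\frac{\varphi(n)}{\varphi(d_{2^k})}&\lambda_1&\lambda_2\\\varphi(n)+n-n_0-1&\varphi(d_2)&\varphi(d_3)&\dots&\varphi(d_{2^k})&1&1\end{pmatrix},$$ where $$\lambda_1,\lambda_2=\left(n-2+\frac{\varphi(n)}{2}\right)\pm\sqrt{n^2+\left(\frac{3\varphi(n)}{2}\right)^2-2n\varphi(n)}.$$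
   Context: The dihedral group is $D_n=\langle r,s : r^n=s^2=1,\ srs=r^{-1}\rangle$, of order $2n$. The generating graph $\Gamma(G)$ of a group $G$ is the simple undirected graph with vertex set $G$ in which two distinct vertices $g,h$ are adjacent iff $\langle g,h\rangle=G$. The distance spectrum of a connected graph is the spectrum of its distance matrix, whose $(u,v)$ entry is the length $d(u,v)$ of a shortest path from $u$ to $v$. $\varphi$ is Euler's totient function and $\mu$ the Möbius function. In the two-row notation for a spectrum, the top row lists eigenvalues and the bottom row their multiplicities; the spectrum is a multiset (if the same number appears in several columns, the multiplicities add, and columns with multiplicity $0$ are void). *)

theory Defs
  imports
    "HOL-Algebra.Generated_Groups"
    "HOL-Computational_Algebra.Computational_Algebra"
    "HOL-Number_Theory.Totient"
    "Graph_Theory.Graph_Theory"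
    "Jordan_Normal_Form.Char_Poly"
begin

text \<open>
  The group \<open>D\<^sub>n\<close> up to isomorphism, for \<open>n \<ge> 1\<close>: a group generated by elements satisfying the
  relations of the presentation is a quotient of the presented group, which has order \<open>2n\<close>, so
  the condition on the order excludes exactly the proper quotients.
\<close>

locale dihedral_group = group G for G (structure) +
  fixes n :: nat and r s :: 'a
  assumes r_carrier: "r \<in> carrier G"
    and s_carrier: "s \<in> carrier G"
    and generators: "generate G {r, s} = carrier G"
    and r_pow: "r [^] n = \<one>"
    and s_pow: "s [^] (2::nat) = \<one>"
    and conj: "s \<otimes> r \<otimes> s = inv r"
    and order_eq: "Coset.order G = 2 * n"

text \<open>
  Undirected graphs are symmetric digraphs, as in the library: an edge is a pair of opposite arcs.
\<close>

definition generating_graph :: "('a, 'b) monoid_scheme \<Rightarrow> ('a, 'a \<times> 'a) pre_digraph" where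
  "generating_graph G = with_proj
    \<lparr> pverts = carrier G,
      parcs = {(g, h). g \<in> carrier G \<and> h \<in> carrier G \<and> g \<noteq> h \<and> generate G {g, h} = carrier G} \<rparr>"

definition remove_isolated :: "('a, 'b) pre_digraph \<Rightarrow> ('a, 'b) pre_digraph" where
  "remove_isolated D = D \<restriction> {v \<in> verts D. in_arcs D v \<noteq> {} \<or> out_arcs D v \<noteq> {}}"

text \<open>
  The list \<open>vs\<close> fixes the order of the rows and columns. Outside connected digraphs the entries
  are meaningless, since \<^const>\<open>real_of_ereal\<close> sends an infinite distance to 0.
\<close>

definition distance_matrix :: "('a, 'b) pre_digraph \<Rightarrow> 'a list \<Rightarrow> real mat" where
  "distance_matrix D vs = mat (length vs) (length vs)
    (\<lambda>(i, j). real_of_ereal (wf_digraph.\<mu> D (\<lambda>_. 1) (vs ! i) (vs ! j)))"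

text \<open>
  The multiset of real roots of the characteristic polynomial is the whole spectrum, because the
  distance matrix of an undirected graph is real symmetric. Connectedness, without which there is
  no distance spectrum, is part of the assertion.
\<close>

definition has_distance_spectrum :: "('a, 'b) pre_digraph \<Rightarrow> real multiset \<Rightarrow> bool" where
  "has_distance_spectrum D M \<longleftrightarrow>
    graph D \<and> Digraph_Component.connected D \<and>
    (\<forall>vs. distinct vs \<and> set vs = verts D \<longrightarrow> proots (char_poly (distance_matrix D vs)) = M)"

definition moebius_mu :: "nat \<Rightarrow> int" where
  "moebius_mu m = (if squarefree m then (- 1) ^ card (prime_factors m) else 0)"


text \<open>A concrete model, showing that \<^locale>\<open>dihedral_group\<close> is inhabited for every \<open>n \<ge> 1\<close>.\<close>

definition dihedral_model :: "nat \<Rightarrow> (int \<times> bool) monoid" where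
  "dihedral_model n =
    \<lparr> carrier = {0..<int n} \<times> UNIV,
      monoid.mult = (\<lambda>(i, a) (j, b). ((i + (if a then - j else j)) mod int n, a \<noteq> b)),
      one = (0, False) \<rparr>"

lemma dihedral_model_group:
  assumes "n \<ge> 1"
  shows "group (dihedral_model n)"
proof (rule groupI)
  fix x assume x: "x \<in> carrier (dihedral_model n)"
  obtain i a where [simp]: "x = (i, a)" by (cases x)
  show "\<exists>y\<in>carrier (dihedral_model n). y \<otimes>\<^bsub>dihedral_model n\<^esub> x = \<one>\<^bsub>dihedral_model n\<^esub>"
  proof (cases a)
    case True
    then show ?thesis using x
      by (intro bexI[of _ "(i, True)"]) (auto simp: dihedral_model_def)
  next
    case False
    then show ?thesis using x assms
      by (intro bexI[of _ "((- i) mod int n, False)"]) (auto simp: dihedral_model_def mod_simps)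
  qed
qed (use assms in \<open>auto simp: dihedral_model_def mod_simps algebra_simps\<close>)

lemma dihedral_model:
  assumes n: "n \<ge> 1"
  shows "dihedral_group (dihedral_model n) n (1 mod int n, False) (0, True)"
proof -
  let ?G = "dihedral_model n" and ?r = "(1 mod int n, False)" and ?s = "(0::int, True)"
  interpret group ?G using n by (rule dihedral_model_group)
  have rc: "?r \<in> carrier ?G" and sc: "?s \<in> carrier ?G"
    using n by (auto simp: dihedral_model_def)
  have pow: "?r [^]\<^bsub>?G\<^esub> m = (int m mod int n, False)" for m :: nat
    by (induction m) (auto simp: dihedral_model_def nat_pow_def mod_simps algebra_simps)
  have rm: "(int m mod int n, False) \<in> generate ?G {?r, ?s}" for m :: nat
  proof (induction m)
    case 0
    then show ?case using generate.one[of ?G "{?r, ?s}"] by (simp add: dihedral_model_def)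
  next
    case (Suc m)
    have "(int m mod int n, False) \<otimes>\<^bsub>?G\<^esub> ?r \<in> generate ?G {?r, ?s}"
      using Suc by (intro generate.eng) (auto intro: generate.incl)
    then show ?case by (simp add: dihedral_model_def mod_simps algebra_simps)
  qed
  have "x \<in> generate ?G {?r, ?s}" if x: "x \<in> carrier ?G" for x
  proof -
    obtain i a where xi: "x = (i, a)" by (cases x)
    have i: "0 \<le> i" "i < int n" using x by (auto simp: xi dihedral_model_def)
    have 1: "(i, False) \<in> generate ?G {?r, ?s}" using rm[of "nat i"] i by simp
    have "(i, False) \<otimes>\<^bsub>?G\<^esub> ?s \<in> generate ?G {?r, ?s}"
      using 1 by (intro generate.eng) (auto intro: generate.incl)
    then have "(i, True) \<in> generate ?G {?r, ?s}" using i by (simp add: dihedral_model_def)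
    with 1 show ?thesis by (cases a) (auto simp: xi)
  qed
  then have "generate ?G {?r, ?s} = carrier ?G"
    using generate_in_carrier[of "{?r, ?s}"] rc sc by blast
  moreover have "?s \<otimes>\<^bsub>?G\<^esub> ?r \<otimes>\<^bsub>?G\<^esub> ?s = inv\<^bsub>?G\<^esub> ?r"
  proof (rule inv_equality[symmetric])
    show "?s \<otimes>\<^bsub>?G\<^esub> ?r \<otimes>\<^bsub>?G\<^esub> ?s \<otimes>\<^bsub>?G\<^esub> ?r = \<one>\<^bsub>?G\<^esub>"
      by (simp add: dihedral_model_def mod_simps)
  qed (use rc sc in auto)
  moreover have "?s [^]\<^bsub>?G\<^esub> (2::nat) = \<one>\<^bsub>?G\<^esub>"
    by (simp add: numeral_2_eq_2 dihedral_model_def nat_pow_def)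
  moreover have "Coset.order ?G = 2 * n"
    by (simp add: Coset.order_def dihedral_model_def card_cartesian_product)
  moreover have "?r [^]\<^bsub>?G\<^esub> n = \<one>\<^bsub>?G\<^esub>"
    using pow[of n] by (simp add: dihedral_model_def)
  ultimately show ?thesis
    using rc sc by unfold_locales
qed

end

theory Submission
  imports Defs
begin

text \<open>
  A rotation \<open>r\<^sup>u\<close> is non-isolated iff \<open>u\<close> is prime to \<open>n\<close>; such rotations are adjacent to all
  reflections and to no other rotation, and \<open>r\<^sup>i s\<close>, \<open>r\<^sup>j s\<close> are adjacent iff \<open>i - j\<close> is prime to \<open>n\<close>.
  All other distances are 2, so the block of reflections is circulant and is diagonalised by the
  characters of \<open>\<int>/n\<close>, with Ramanujan sums as eigenvalues of its adjacency part. Sum-zero functions on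
  the rotations are eigenvectors for \<open>-2\<close>, and the functions constant on rotations and on reflections
  contribute the two remaining eigenvalues. The resulting complex eigenbasis is orthogonal, which
  gives the characteristic polynomial.
\<close>

section \<open>Ramanujan sums\<close>

text \<open>The eigenvalue of the reflection block at frequency \<open>j\<close> depends only on the
  order \<open>t = n div gcd j n\<close> of the character, and \<open>totient t\<close> frequencies
  share that order; this produces the multiplicities. Order 1 is the constant function, which mixes
  with the constant function on rotations in a 2x2 problem, so the divisor 1 has no column of its
  own. Non-squarefree orders have Moebius value 0 and fall back to \<open>-2\<close>; there are
  \<open>n - n0\<close> such frequencies, since the totients of the divisors of \<open>n0\<close>
  add up to \<open>n0\<close>. Eigenvalues of different origin may coincide, so multiplicities are
  not read off from eigenspaces: every eigenvector of a full orthogonal family is counted once. The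
  group is abstract and the order of the rows arbitrary; the linear algebra is therefore done over
  labels that depend on \<open>n\<close> alone, and the group theory has to show that they enumerate
  the non-isolated vertices with the right distances.\<close>

definition unity_root :: "nat \<Rightarrow> complex" where
  "unity_root m = cis (2 * pi / real m)"

lemma unity_root_power_eq_1_iff:
  assumes "m > 0"
  shows "unity_root m ^ a = 1 \<longleftrightarrow> m dvd a"
proof -
  have "unity_root m ^ a = cis (real a * (2 * pi / real m))"
    by (simp add: unity_root_def DeMoivre)
  also have "\<dots> = 1 \<longleftrightarrow> (\<exists>k::int. real a * (2 * pi / real m) = k * 2 * pi)"
    by (auto simp: complex_eq_iff cos_one_sin_zero simp flip: cos_one_2pi_int)
  also have "\<dots> \<longleftrightarrow> (\<exists>k::int. int a = k * int m)"
  proof -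
    have "real a * (2 * pi / real m) = real_of_int k * 2 * pi \<longleftrightarrow> int a = k * int m" for k
    proof -
      have "real a * (2 * pi / real m) = real_of_int k * 2 * pi \<longleftrightarrow> real a = real_of_int k * real m"
        using assms by (simp add: field_simps)
      also have "\<dots> \<longleftrightarrow> real_of_int (int a) = real_of_int (k * int m)" by simp
      also have "\<dots> \<longleftrightarrow> int a = k * int m" by (rule of_int_eq_iff)
      finally show ?thesis .
    qed
    then show ?thesis by simp
  qed
  also have "\<dots> \<longleftrightarrow> int m dvd int a" by (auto simp: dvd_def mult.commute)
  finally show ?thesis by simp
qed

lemma unity_root_power_mod:
  assumes "m > 0"
  shows "unity_root m ^ (a mod m) = unity_root m ^ a"
proof -
  have "unity_root m ^ a = unity_root m ^ (m * (a div m) + a mod m)" by simp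
  also have "\<dots> = unity_root m ^ (a mod m)"
    using unity_root_power_eq_1_iff[OF assms, of "m * (a div m)"]
    by (simp only: power_add) simp
  finally show ?thesis by simp
qed

lemma sum_unity_root_powers:
  assumes "m > 0"
  shows "(\<Sum>i<m. unity_root m ^ (j * i)) = (if m dvd j then of_nat m else 0)"
proof (cases "m dvd j")
  case True
  then have "unity_root m ^ (j * i) = 1" for i
    using assms by (simp add: unity_root_power_eq_1_iff)
  with True show ?thesis by simp
next
  case False
  let ?z = "unity_root m ^ j"
  have "?z \<noteq> 1" using False assms by (simp add: unity_root_power_eq_1_iff)
  moreover have "?z ^ m = 1"
    using assms by (simp add: unity_root_power_eq_1_iff flip: power_mult)
  ultimately have "(\<Sum>i<m. ?z ^ i) = 0" by (simp add: sum_gp_strict)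
  with False show ?thesis by (simp add: power_mult)
qed

lemma cnj_unity_root_power:
  "cnj (unity_root m ^ a) * unity_root m ^ a = 1"
  by (simp add: unity_root_def DeMoivre cis_cnj cis_mult)

lemma sum_cnj_unity_root_powers:
  assumes "j < m" "j' < m"
  shows "(\<Sum>i<m. cnj (unity_root m ^ (j * i)) * unity_root m ^ (j' * i)) =
    (if j = j' then of_nat m else 0)"
proof -
  have m: "m > 0" using assms by simp
  \<comment> \<open>Exponents are natural numbers, so the conjugate of frequency \<open>j\<close> is
    rewritten as frequency \<open>m - j\<close>; orthogonality then reduces to a geometric
    sum.\<close>
  have "cnj (unity_root m ^ (j * i)) * unity_root m ^ (j' * i) = unity_root m ^ ((j' + (m - j)) * i)" for i
  proof -
    have "unity_root m ^ ((j' + (m - j)) * i) * unity_root m ^ (j * i) = unity_root m ^ ((j' + m) * i)"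
      using assms by (simp flip: power_add distrib_right)
    also have "\<dots> = unity_root m ^ (j' * i)"
      using m by (simp add: distrib_right power_add unity_root_power_eq_1_iff)
    finally have *: "unity_root m ^ (j' * i) = unity_root m ^ ((j' + (m - j)) * i) * unity_root m ^ (j * i)"
      by (rule sym)
    have "cnj (unity_root m ^ (j * i)) * unity_root m ^ (j' * i) =
        unity_root m ^ ((j' + (m - j)) * i) * (cnj (unity_root m ^ (j * i)) * unity_root m ^ (j * i))"
      unfolding * by (simp only: ac_simps)
    then show ?thesis by (simp only: cnj_unity_root_power mult_1_right)
  qed
  moreover have "m dvd j' + (m - j) \<longleftrightarrow> j = j'"
  proof
    assume d: "m dvd j' + (m - j)"
    then obtain k where k: "j' + (m - j) = m * k" by (auto elim: dvdE)
    \<comment> \<open>\<open>j' + (m - j)\<close> lies strictly between 0 and \<open>2 * m\<close>,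
      so the only multiple of \<open>m\<close> it can be is \<open>m\<close> itself.\<close>
    have "k < 2" using k assms mult_le_mono2[of 2 k m] by linarith
    then have "k = 0 \<or> k = 1" by auto
    with k assms show "j = j'" by auto
  qed (use assms in auto)
  ultimately show ?thesis using sum_unity_root_powers[OF m, of "j' + (m - j)"] by simp
qed

text \<open>Substituting \<open>y = D * z\<close> leaves a full sum over the powers of a primitive
  root of order \<open>n div D\<close>. The condition is phrased through the order
  \<open>n div gcd j n\<close> of the character because the Ramanujan sum is evaluated in terms of
  that order.\<close>

lemma sum_unity_root_powers_multiples:
  assumes n: "n > 0" and D: "D dvd n"
  shows "(\<Sum>y | y < n \<and> D dvd y. unity_root n ^ (j * y)) =
    (if n div gcd j n dvd D then of_nat (n div D) else 0)"
proof -
  have D0: "D > 0" using n D by (auto intro: Nat.gr0I)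
  define m where "m = n div D"
  have m: "n = D * m" "m > 0" using n D by (auto simp: m_def)
  have *: "unity_root n ^ D = unity_root m"
    using m D0 by (simp add: unity_root_def DeMoivre)
  have "(\<Sum>y | y < n \<and> D dvd y. unity_root n ^ (j * y)) = (\<Sum>z<m. unity_root m ^ (j * z))"
  proof (rule sum.reindex_bij_witness[of _ "\<lambda>z. D * z" "\<lambda>y. y div D"])
    fix y assume "y \<in> {y. y < n \<and> D dvd y}"
    then show "unity_root m ^ (j * (y div D)) = unity_root n ^ (j * y)"
      by (auto simp flip: * power_mult simp: mult_ac elim!: dvdE)
  qed (use m D0 in auto)
  also have "\<dots> = (if m dvd j then of_nat m else 0)" using m by (intro sum_unity_root_powers)
  also have "m dvd j \<longleftrightarrow> n div gcd j n dvd D"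
  proof -
    define g where "g = gcd j n"
    have g: "g > 0" using n by (simp add: g_def)
    obtain j' t where jt: "j = j' * g" "n = t * g" "coprime j' t"
      using gcd_coprime_exists[of j n] g g_def by force
    have "m dvd j \<longleftrightarrow> D * m dvd D * j" using D0 by simp
    also have "\<dots> \<longleftrightarrow> t * g dvd D * j' * g" using m jt by (simp add: mult_ac)
    also have "\<dots> \<longleftrightarrow> t dvd D * j'" using g by simp
    also have "\<dots> \<longleftrightarrow> t dvd D" using jt(3) by (simp add: coprime_commute coprime_dvd_mult_left_iff)
    also have "t = n div g" using g by (subst jt(2)) simp
    finally show ?thesis by (simp add: g_def)
  qed
  finally show ?thesis by (simp add: m_def)
qed

section \<open>Squarefree divisors and the radical\<close>

lemma prod_primes_dvd_iff:
  fixes y :: nat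
  assumes "finite S" "\<And>p. p \<in> S \<Longrightarrow> prime p"
  shows "\<Prod>S dvd y \<longleftrightarrow> (\<forall>p\<in>S. p dvd y)"
  using assms
proof (induction S)
  case (insert q S)
  have "coprime q (\<Prod>S)"
    using insert by (intro prod_coprime_right) (metis insertCI primes_coprime)
  then show ?case using insert by (auto intro: divides_mult dest: dvd_mult_left dvd_mult_right)
qed simp

lemma squarefree_prod_primes:
  fixes S :: "nat set"
  assumes "finite S" "\<And>p. p \<in> S \<Longrightarrow> prime p"
  shows "squarefree (\<Prod>S)"
  using assms by (intro squarefree_prod_coprime) (auto intro: primes_coprime squarefree_prime)

lemma prod_prime_factors_squarefree:
  fixes t :: nat
  assumes "squarefree t"
  shows "\<Prod>(prime_factors t) = t"
proof -
  have t0: "t \<noteq> 0" using assms not_squarefree_0 by metis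
  have "t = (\<Prod>p\<in>prime_factors t. p ^ multiplicity p t)"
    using t0 by (simp add: prod_prime_factors)
  also have "\<dots> = \<Prod>(prime_factors t)"
    using assms t0 by (intro prod.cong) (auto simp: squarefree_factorial_semiring')
  finally show ?thesis by simp
qed

text \<open>Identifies the divisors of \<open>n0\<close> in the theorem with the orders at which the
  Moebius function does not vanish. A squarefree \<open>t\<close> is the product of its primes, and
  these are among the primes of \<open>n\<close>.\<close>

lemma squarefree_dvd_iff_dvd_radical:
  fixes n t :: nat
  assumes "n > 0"
  shows "t dvd \<Prod>(prime_factors n) \<longleftrightarrow> t dvd n \<and> squarefree t"
proof
  assume t: "t dvd \<Prod>(prime_factors n)"
  have "\<Prod>(prime_factors n) dvd n" by (subst prod_primes_dvd_iff) auto
  moreover have "squarefree (\<Prod>(prime_factors n))" by (rule squarefree_prod_primes) auto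
  ultimately show "t dvd n \<and> squarefree t"
    using t by (meson dvd_trans squarefree_mono)
next
  assume t: "t dvd n \<and> squarefree t"
  then have "prime_factors t \<subseteq> prime_factors n" using assms by (auto simp: in_prime_factors_iff)
  then have "\<Prod>(prime_factors t) dvd \<Prod>(prime_factors n)" by (intro prod_dvd_prod_subset) auto
  then show "t dvd \<Prod>(prime_factors n)" using t prod_prime_factors_squarefree by simp
qed

text \<open>
  Expanding the indicator of coprimality over sets of prime divisors of \<open>n\<close>, only the sets whose
  product is a multiple of \<open>t\<close> survive; both sides are then products over the primes of \<open>n\<close>.
\<close>

lemma ramanujan_sum:
  fixes n j :: nat
  assumes n: "n > 0"
  defines "t \<equiv> n div gcd j n"
  shows "(\<Sum>y | y < n \<and> coprime y n. unity_root n ^ (j * y)) =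
    of_real (of_int (moebius_mu t) * (real (totient n) / real (totient t)))"
proof -
  define P where "P = prime_factors n"
  have finP: "finite P" and prP: "\<And>p. p \<in> P \<Longrightarrow> prime p" by (auto simp: P_def)
  have tn: "t dvd n" by (metis t_def dvd_mult_div_cancel dvd_triv_right gcd_dvd2)
  have t0: "t > 0" using tn n by (auto intro: Nat.gr0I)
  have Sn: "\<Prod>S dvd n" if "S \<in> Pow P" for S
    using that by (subst prod_primes_dvd_iff) (auto simp: P_def finite_subset)
  have ind: "(if coprime y n then 1 else 0) =
      (\<Sum>S\<in>Pow P. (-1) ^ card S * (if \<Prod>S dvd y then 1 else 0 :: complex))" for y
  proof -
    have "coprime y n \<longleftrightarrow> (\<forall>p\<in>P. \<not> p dvd y)"
    proof
      assume "coprime y n"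
      then show "\<forall>p\<in>P. \<not> p dvd y"
        by (metis P_def coprime_common_divisor_nat in_prime_factors_iff not_prime_1)
    next
      assume *: "\<forall>p\<in>P. \<not> p dvd y"
      show "coprime y n"
      proof (rule ccontr)
        assume "\<not> coprime y n"
        then obtain p where "prime p" "p dvd y" "p dvd n"
          by (metis coprime_iff_gcd_eq_1 gcd_nat.bounded_iff prime_factor_nat)
        with * n show False by (auto simp: P_def in_prime_factors_iff)
      qed
    qed
    then have "(if coprime y n then 1 else 0) = (\<Prod>p\<in>P. 1 - (if p dvd y then 1 else 0 :: complex))"
      using finP by (auto intro!: prod_zero[symmetric] prod.neutral[symmetric])
    also have "\<dots> = (\<Sum>S\<in>Pow P. (-1) ^ card S * (\<Prod>p\<in>S. if p dvd y then 1 else 0))"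
      using finP by (simp add: prod_diff_conv_sum)
    also have "(\<Prod>p\<in>S. if p dvd y then 1 else 0 :: complex) = (if \<Prod>S dvd y then 1 else 0)"
      if "S \<in> Pow P" for S
    proof -
      have f: "finite S" "\<And>p. p \<in> S \<Longrightarrow> prime p" using that finP prP by (auto intro: finite_subset)
      show ?thesis
        using f(1) prod_primes_dvd_iff[OF f] by (auto intro!: prod_zero prod.neutral)
    qed
    then have "(\<Sum>S\<in>Pow P. (-1) ^ card S * (\<Prod>p\<in>S. if p dvd y then 1 else 0 :: complex)) =
      (\<Sum>S\<in>Pow P. (-1) ^ card S * (if \<Prod>S dvd y then 1 else 0))"
      by (intro sum.cong) auto
    finally show ?thesis .
  qed
  have "(\<Sum>y | y < n \<and> coprime y n. unity_root n ^ (j * y)) =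
    (\<Sum>y<n. (if coprime y n then 1 else 0) * unity_root n ^ (j * y))"
    by (rule sum.mono_neutral_cong_left) auto
  also have "\<dots> = (\<Sum>y<n. \<Sum>S\<in>Pow P. (-1) ^ card S * ((if \<Prod>S dvd y then 1 else 0) * unity_root n ^ (j * y)))"
    unfolding ind sum_distrib_right by (simp only: mult.assoc)
  also have "\<dots> = (\<Sum>S\<in>Pow P. \<Sum>y<n. (-1) ^ card S * ((if \<Prod>S dvd y then 1 else 0) * unity_root n ^ (j * y)))"
    by (rule sum.swap)
  also have "\<dots> = (\<Sum>S\<in>Pow P. (-1) ^ card S * (\<Sum>y | y < n \<and> \<Prod>S dvd y. unity_root n ^ (j * y)))"
  proof (rule sum.cong[OF refl])
    fix S assume "S \<in> Pow P"
    have "(\<Sum>y<n. (if \<Prod>S dvd y then 1 else 0) * unity_root n ^ (j * y)) =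
      (\<Sum>y | y < n \<and> \<Prod>S dvd y. unity_root n ^ (j * y))"
      by (rule sum.mono_neutral_cong_right) auto
    then show "(\<Sum>y<n. (-1) ^ card S * ((if \<Prod>S dvd y then 1 else 0) * unity_root n ^ (j * y))) =
      (-1) ^ card S * (\<Sum>y | y < n \<and> \<Prod>S dvd y. unity_root n ^ (j * y))"
      by (simp flip: sum_distrib_left)
  qed
  also have "\<dots> = (\<Sum>S\<in>Pow P. (-1) ^ card S * (if t dvd \<Prod>S then of_nat (n div \<Prod>S) else 0))"
    using n Sn by (intro sum.cong refl) (simp add: sum_unity_root_powers_multiples t_def)
  also have "\<dots> = of_real (of_int (moebius_mu t) * (real (totient n) / real (totient t)))"
  proof (cases "squarefree t")
    case False
    \<comment> \<open>A product of distinct primes has only squarefree divisors, so every term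
      vanishes, and so does the Moebius value.\<close>
    have "\<not> t dvd \<Prod>S" if "S \<in> Pow P" for S
    proof -
      have "squarefree (\<Prod>S)" using that finP prP by (intro squarefree_prod_primes) (auto intro: finite_subset)
      with False show ?thesis using squarefree_mono by blast
    qed
    then have "(\<Sum>S\<in>Pow P. (-1) ^ card S * (if t dvd \<Prod>S then of_nat (n div \<Prod>S) else 0)) = (0 :: complex)"
      by (intro sum.neutral) auto
    then show ?thesis using False by (simp add: moebius_mu_def)
  next
    case True
    define T where "T = prime_factors t"
    have TP: "T \<subseteq> P" using tn n by (auto simp: T_def P_def in_prime_factors_iff)
    have finT: "finite T" by (simp add: T_def)
    have tT: "t = \<Prod>T" using True by (simp add: T_def prod_prime_factors_squarefree)
    have pos: "real p > 0" if "p \<in> P" for p using prP[OF that] by (simp add: prime_gt_0_nat)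
    have lt1: "1 - 1 / real p > 0" if "p \<in> P" for p
      using prime_gt_1_nat[OF prP[OF that]] by simp
    have dvd_iff: "t dvd \<Prod>S \<longleftrightarrow> T \<subseteq> S" if "S \<in> Pow P" for S
    proof
      assume "T \<subseteq> S"
      then show "t dvd \<Prod>S" unfolding tT using that finP by (intro prod_dvd_prod_subset) (auto intro: finite_subset)
    next
      assume *: "t dvd \<Prod>S"
      show "T \<subseteq> S"
      proof
        fix p assume p: "p \<in> T"
        then have pp: "prime p" "p dvd \<Prod>S" using * by (auto simp: T_def in_prime_factors_iff)
        have "finite S" using that finP by (auto intro: finite_subset)
        then obtain q where q: "q \<in> S" "p dvd q"
          using pp prime_dvd_prod_iff[of S p "\<lambda>x. x"] by auto
        then have "p = q" using pp(1) that prP by (intro primes_dvd_imp_eq) auto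
        with q show "p \<in> S" by simp
      qed
    qed
    \<comment> \<open>The condition \<open>T \<subseteq> S\<close> is encoded as a product of zeros
      and ones over \<open>P - S\<close>. The sum then has the shape of an expanded product over
      \<open>P\<close>, with factor \<open>0 - 1/p\<close> for \<open>p\<close> in \<open>T\<close>
      and \<open>1 - 1/p\<close> otherwise.\<close>
    have "(\<Sum>S\<in>Pow P. (-1) ^ card S * (if t dvd \<Prod>S then of_nat (n div \<Prod>S) else 0)) =
      (\<Sum>S\<in>Pow P. complex_of_real (real n * ((-1) ^ card S * (\<Prod>p\<in>S. 1 / real p) * (\<Prod>p\<in>P-S. if p \<in> T then 0 else 1))))"
    proof (rule sum.cong[OF refl])
      fix S assume S: "S \<in> Pow P"
      have "(\<Prod>p\<in>P-S. if p \<in> T then 0 else 1 :: real) = (if t dvd \<Prod>S then 1 else 0)"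
        using finP TP by (auto simp: dvd_iff[OF S] intro!: prod_zero prod.neutral)
      moreover have "real (n div \<Prod>S) = real n * (\<Prod>p\<in>S. 1 / real p)"
        using Sn[OF S] by (simp add: real_of_nat_div prod_dividef)
      then have "of_nat (n div \<Prod>S) = complex_of_real (real n * (\<Prod>p\<in>S. 1 / real p))"
        by (metis of_real_of_nat_eq)
      ultimately show "(-1) ^ card S * (if t dvd \<Prod>S then of_nat (n div \<Prod>S) else 0) =
        complex_of_real (real n * ((-1) ^ card S * (\<Prod>p\<in>S. 1 / real p) * (\<Prod>p\<in>P-S. if p \<in> T then 0 else 1)))"
        by (simp del: of_nat_prod)
    qed
    also have "\<dots> = complex_of_real (real n * (\<Prod>p\<in>P. (if p \<in> T then 0 else 1) - 1 / real p))"
      by (simp only: prod_diff_conv_sum[OF finP] sum_distrib_left of_real_sum)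
    also have "(\<Prod>p\<in>P. (if p \<in> T then 0 else 1) - 1 / real p) =
        (\<Prod>p\<in>P-T. 1 - 1 / real p) * (\<Prod>p\<in>T. - (1 / real p))"
      using finP TP by (subst prod.subset_diff[OF TP finP]) simp
    also have "(\<Prod>p\<in>T. - (1 / real p)) = (-1) ^ card T / real t"
      by (simp add: prod_uminus prod_dividef tT)
    also have "real n * ((\<Prod>p\<in>P-T. 1 - 1 / real p) * ((-1) ^ card T / real t)) =
       of_int (moebius_mu t) * (real (totient n) / real (totient t))"
    \<comment> \<open>By Euler's product formula the factors over \<open>P - T\<close> are
      \<open>totient n / n\<close> divided by \<open>totient t / t\<close>; the product over
      \<open>T\<close> common to both totients is positive and cancels.\<close>
    proof -
      have "real (totient n) = real n * ((\<Prod>p\<in>P-T. 1 - 1 / real p) * (\<Prod>p\<in>T. 1 - 1 / real p))"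
        unfolding totient_formula2[of n] P_def[symmetric] by (subst prod.subset_diff[OF TP finP]) simp
      moreover have "real (totient t) = real t * (\<Prod>p\<in>T. 1 - 1 / real p)"
        unfolding totient_formula2[of t] T_def ..
      moreover have "(\<Prod>p\<in>T. 1 - 1 / real p) > 0"
        using TP lt1 by (intro prod_pos) auto
      moreover have "real_of_int (moebius_mu t) = (-1) ^ card T"
        using True by (simp add: moebius_mu_def T_def)
      moreover have "a * (X * (s / b)) = s * ((a * (X * Y)) / (b * Y))" if "Y > 0" for a b s X Y :: real
        using that by simp
      ultimately show ?thesis by presburger
    qed
    finally show ?thesis .
  qed
  finally show ?thesis .
qed

section \<open>Multiplicities: frequencies counted by their order\<close>

lemma sum_singleton_mset_const:
  "finite A \<Longrightarrow> (\<Sum>a\<in>A. {#c#}) = replicate_mset (card A) c"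
  by (induction A rule: finite_induct) auto

lemma sum_replicate_mset_const:
  "(\<Sum>a\<in>A. replicate_mset (f a) c) = replicate_mset (sum f A) c"
  by (rule multiset_eqI) (simp add: count_sum)

lemma sum_over_gcd_quotients:
  assumes n: "n > 0"
  shows "(\<Sum>j<n. {#g (n div gcd j n)#}) = (\<Sum>t | t dvd n. replicate_mset (totient t) (g t))"
proof -
  \<comment> \<open>Frequency 0 is exchanged for \<open>n\<close>, which has the same gcd with
    \<open>n\<close>, because the totient count of numbers with a given gcd runs over
    \<open>{0<..n}\<close>.\<close>
  have "(\<Sum>j<n. {#g (n div gcd j n)#}) = (\<Sum>j\<in>{0<..n}. {#g (n div gcd j n)#})"
    using n by (intro sum.reindex_bij_witness[of _ "\<lambda>j. if j = n then 0 else j" "\<lambda>j. if j = 0 then n else j"]) auto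
  also have "\<dots> = (\<Sum>d | d dvd n. \<Sum>j\<in>{j. j \<in> {0<..n} \<and> gcd j n = d}. {#g (n div gcd j n)#})"
    using n by (intro sum.group[symmetric]) auto
  also have "\<dots> = (\<Sum>d | d dvd n. replicate_mset (totient (n div d)) (g (n div d)))"
  proof (rule sum.cong[OF refl])
    fix d assume d: "d \<in> {d. d dvd n}"
    have "(\<Sum>j\<in>{j. j \<in> {0<..n} \<and> gcd j n = d}. {#g (n div gcd j n)#}) =
      (\<Sum>j\<in>{j. j \<in> {0<..n} \<and> gcd j n = d}. {#g (n div d)#})"
      by (rule sum.cong) auto
    also have "\<dots> = replicate_mset (totient (n div d)) (g (n div d))"
      using card_gcd_eq_totient[of n d] n d by (simp add: sum_singleton_mset_const)
    finally show "(\<Sum>j\<in>{j. j \<in> {0<..n} \<and> gcd j n = d}. {#g (n div gcd j n)#}) = \<dots>" .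
  qed
  also have "\<dots> = (\<Sum>t | t dvd n. replicate_mset (totient t) (g t))"
    using n by (intro sum.reindex_bij_witness[of _ "\<lambda>d. n div d" "\<lambda>d. n div d"])
      (auto elim!: dvdE)
  finally show ?thesis .
qed

text \<open>Frequency 0 has order 1, so leaving it out removes exactly the divisor 1. All
  non-squarefree orders contribute the value \<open>x\<close>; their number is \<open>n\<close>
  minus the sum of \<open>totient t\<close> over the divisors of \<open>n0\<close>, that is
  \<open>n - n0\<close>.\<close>

lemma ramanujan_sum_mset:
  fixes n :: nat and x :: real
  assumes n: "n > 0"
  defines "c \<equiv> \<lambda>t. of_int (moebius_mu t) * (real (totient n) / real (totient t))"
    and "n0 \<equiv> \<Prod>(prime_factors n)"
  shows "(\<Sum>j\<in>{0<..<n}. {#x - c (n div gcd j n)#}) =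
     replicate_mset (n - n0) x + (\<Sum>t\<in>{t. t dvd n0} - {1}. replicate_mset (totient t) (x - c t))"
proof -
  let ?g = "\<lambda>t. x - c t"
  have n0: "{t. t dvd n0} = {t. t dvd n \<and> squarefree t}"
    using squarefree_dvd_iff_dvd_radical[OF n] by (auto simp: n0_def)
  have fin: "finite {t. t dvd n}" using n by simp
  have "(\<Sum>j<n. {#?g (n div gcd j n)#}) = {#?g 1#} + (\<Sum>j\<in>{0<..<n}. {#?g (n div gcd j n)#})"
  proof -
    have "{..<n} = insert 0 {0<..<n}" using n by auto
    then show ?thesis using n by simp
  qed
  moreover have "(\<Sum>j<n. {#?g (n div gcd j n)#}) = {#?g 1#} + (replicate_mset (n - n0) x +
    (\<Sum>t\<in>{t. t dvd n0} - {1}. replicate_mset (totient t) (x - c t)))"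
  proof -
    have U: "{t. t dvd n} = {t. t dvd n0} \<union> {t. t dvd n \<and> \<not> squarefree t}" using n0 by auto
    have "(\<Sum>j<n. {#?g (n div gcd j n)#}) = (\<Sum>t | t dvd n. replicate_mset (totient t) (?g t))"
      by (rule sum_over_gcd_quotients[OF n])
    also have "\<dots> = (\<Sum>t | t dvd n0. replicate_mset (totient t) (?g t)) +
      (\<Sum>t | t dvd n \<and> \<not> squarefree t. replicate_mset (totient t) (?g t))"
      unfolding U using n0 fin by (intro sum.union_disjoint) auto
    also have "(\<Sum>t | t dvd n \<and> \<not> squarefree t. replicate_mset (totient t) (?g t)) =
      (\<Sum>t | t dvd n \<and> \<not> squarefree t. replicate_mset (totient t) x)"
      by (rule sum.cong) (auto simp: c_def moebius_mu_def)
    also have "\<dots> = replicate_mset (\<Sum>t | t dvd n \<and> \<not> squarefree t. totient t) x"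
      by (rule sum_replicate_mset_const)
    also have "(\<Sum>t | t dvd n \<and> \<not> squarefree t. totient t) = n - n0"
    proof -
      have "n = (\<Sum>t | t dvd n0. totient t) + (\<Sum>t | t dvd n \<and> \<not> squarefree t. totient t)"
        using totient_divisor_sum[of n] unfolding U using n0 fin
        by (subst (asm) sum.union_disjoint) auto
      then show ?thesis by (simp add: totient_divisor_sum)
    qed
    also have "(\<Sum>t | t dvd n0. replicate_mset (totient t) (?g t)) =
       {#?g 1#} + (\<Sum>t\<in>{t. t dvd n0} - {1}. replicate_mset (totient t) (?g t))"
    proof -
      have "finite {t. t dvd n0}" using n0 fin by simp
      then show ?thesis by (subst sum.remove[of _ 1]) auto
    qed
    finally show ?thesis by (simp add: ac_simps)
  qed
  ultimately show ?thesis by simp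
qed

section \<open>Spectra from orthogonal eigenvectors\<close>

lemma diag_char_poly:
  fixes l :: "nat \<Rightarrow> 'a :: comm_ring_1"
  shows "char_poly (mat N N (\<lambda>(i, j). if i = j then l i else 0)) = (\<Prod>i<N. [:- l i, 1:])"
proof -
  let ?B = "mat N N (\<lambda>(i, j). if i = j then l i else 0)"
  have "char_poly ?B = (\<Prod>a\<leftarrow>diag_mat ?B. [:- a, 1:])"
    by (rule char_poly_upper_triangular[of _ N]) (auto simp: upper_triangular_def)
  also have "diag_mat ?B = map l [0..<N]" by (auto simp: diag_mat_def)
  finally show ?thesis
    by (simp add: prod.list_conv_set_nth comp_def atLeast0LessThan)
qed

lemma sum_nth_distinct:
  assumes "distinct xs"
  shows "(\<Sum>i<length xs. f (xs ! i)) = sum f (set xs)"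
  using assms by (intro sum.reindex_bij_betw bij_betw_nth) auto

lemma prod_nth_distinct:
  assumes "distinct xs"
  shows "(\<Prod>i<length xs. f (xs ! i)) = prod f (set xs)"
  using assms by (intro prod.reindex_bij_betw bij_betw_nth) auto

text \<open>As many orthogonal nonzero vectors as the dimension form an invertible matrix with an
  explicit inverse, which diagonalises \<open>A\<close>. Orthogonality is also demanded between
  vectors with equal \<open>l\<close>, so repeated eigenvalues receive their multiplicity with no
  separate independence argument.\<close>

lemma char_poly_orthogonal_eigenbasis:
  fixes A :: "'v \<Rightarrow> 'v \<Rightarrow> complex" and F :: "'w \<Rightarrow> 'v \<Rightarrow> complex"
  assumes vs: "distinct vs" and W: "finite W" "card W = length vs"
    and eigen: "\<And>w v. w \<in> W \<Longrightarrow> v \<in> set vs \<Longrightarrow> (\<Sum>x\<in>set vs. A v x * F w x) = l w * F w v"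
    and orth: "\<And>w w'. w \<in> W \<Longrightarrow> w' \<in> W \<Longrightarrow> w \<noteq> w' \<Longrightarrow> (\<Sum>x\<in>set vs. cnj (F w x) * F w' x) = 0"
    and nonzero: "\<And>w. w \<in> W \<Longrightarrow> \<exists>x\<in>set vs. F w x \<noteq> 0"
  shows "char_poly (mat (length vs) (length vs) (\<lambda>(i, j). A (vs ! i) (vs ! j))) = (\<Prod>w\<in>W. [:- l w, 1:])"
proof -
  define N where "N = length vs"
  obtain ws where ws: "distinct ws" "set ws = W" using W(1) finite_distinct_list by blast
  have lw: "length ws = N" using ws W(2) distinct_card[of ws] by (simp add: N_def)
  have wsW: "ws ! i \<in> W" if "i < N" for i using that ws lw by auto
  have vsV: "vs ! i \<in> set vs" if "i < N" for i using that by (simp add: N_def)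
  define c where "c w = (\<Sum>x\<in>set vs. cnj (F w x) * F w x)" for w
  have c0: "c w \<noteq> 0" if "w \<in> W" for w
  proof -
    have "c w = of_real (\<Sum>x\<in>set vs. (cmod (F w x))\<^sup>2)"
      unfolding c_def by (simp add: mult.commute flip: complex_norm_square)
    moreover have "(\<Sum>x\<in>set vs. (cmod (F w x))\<^sup>2) > 0"
      using nonzero[OF that] by (auto intro!: sum_pos2)
    ultimately show ?thesis by (metis less_irrefl of_real_eq_0_iff)
  qed
  define M where "M = mat N N (\<lambda>(i, j). A (vs ! i) (vs ! j))"
  define P where "P = mat N N (\<lambda>(i, j). F (ws ! j) (vs ! i))"
  \<comment> \<open>The inverse of \<open>P\<close>: conjugate transpose, each row divided by the
    squared norm \<open>c\<close> of its eigenvector.\<close>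
  define Q where "Q = mat N N (\<lambda>(i, j). cnj (F (ws ! i) (vs ! j)) / c (ws ! i))"
  define B where "B = mat N N (\<lambda>(i, j). if i = j then l (ws ! i) else 0)"
  have carr: "M \<in> carrier_mat N N" "P \<in> carrier_mat N N" "Q \<in> carrier_mat N N" "B \<in> carrier_mat N N"
    by (auto simp: M_def P_def Q_def B_def)
  have sumvs: "(\<Sum>k = 0..<N. f (vs ! k)) = sum f (set vs)" for f :: "'v \<Rightarrow> complex"
    using sum_nth_distinct[OF vs, of f] by (simp add: N_def atLeast0LessThan)
  have QP: "Q * P = 1\<^sub>m N"
  proof (rule eq_matI)
    fix i j assume ij: "i < dim_row (1\<^sub>m N)" "j < dim_col (1\<^sub>m N :: complex mat)"
    then have "(Q * P) $$ (i, j) = (\<Sum>k = 0..<N. cnj (F (ws ! i) (vs ! k)) / c (ws ! i) * F (ws ! j) (vs ! k))"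
      by (simp add: Q_def P_def scalar_prod_def)
    also have "\<dots> = (\<Sum>x\<in>set vs. cnj (F (ws ! i) x) / c (ws ! i) * F (ws ! j) x)" by (rule sumvs)
    also have "\<dots> = (\<Sum>x\<in>set vs. cnj (F (ws ! i) x) * F (ws ! j) x) / c (ws ! i)"
      by (simp add: sum_divide_distrib)
    also have "\<dots> = (if i = j then 1 else 0)"
      using ij wsW c0[OF wsW] orth[of "ws ! i" "ws ! j"] ws(1) lw
      by (auto simp: c_def nth_eq_iff_index_eq)
    finally show "(Q * P) $$ (i, j) = 1\<^sub>m N $$ (i, j)" using ij by simp
  qed (use carr in auto)
  have PQ: "P * Q = 1\<^sub>m N" by (rule mat_mult_left_right_inverse[OF carr(3,2) QP])
  have MP: "M * P = P * B"
  proof (rule eq_matI)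
    fix i j assume "i < dim_row (P * B)" "j < dim_col (P * B)"
    then have ij: "i < N" "j < N" using carr by auto
    then have "(M * P) $$ (i, j) = (\<Sum>k = 0..<N. A (vs ! i) (vs ! k) * F (ws ! j) (vs ! k))"
      by (simp add: M_def P_def scalar_prod_def)
    also have "\<dots> = (\<Sum>x\<in>set vs. A (vs ! i) x * F (ws ! j) x)" by (rule sumvs)
    also have "\<dots> = l (ws ! j) * F (ws ! j) (vs ! i)" using ij wsW vsV by (intro eigen)
    also have "\<dots> = (P * B) $$ (i, j)"
      using ij by (simp add: P_def B_def scalar_prod_def if_distrib[of "\<lambda>x. _ * x"] cong: if_cong)
    finally show "(M * P) $$ (i, j) = (P * B) $$ (i, j)" .
  qed (use carr in auto)
  have "M = M * (P * Q)" using carr PQ by simp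
  also have "\<dots> = P * B * Q" using carr MP by (metis assoc_mult_mat)
  finally have "similar_mat M B" using carr PQ QP by (intro similar_matI[of M B P Q N]) auto
  then have "char_poly M = char_poly B" by (rule char_poly_similar)
  also have "\<dots> = (\<Prod>i<N. [:- l (ws ! i), 1:])" unfolding B_def by (rule diag_char_poly)
  also have "\<dots> = (\<Prod>w\<in>W. [:- l w, 1:])"
    using prod_nth_distinct[OF ws(1), of "\<lambda>w. [:- l w, 1:]"] by (simp add: lw ws(2))
  finally show ?thesis by (simp add: M_def N_def)
qed

text \<open>The eigenvectors are complex, but the matrix and its eigenvalues are real; the
  factorisation over the complex numbers descends because the coefficient embedding is injective on
  polynomials.\<close>

lemma proots_char_poly_orthogonal_eigenbasis:
  fixes A :: "'v \<Rightarrow> 'v \<Rightarrow> real" and F :: "'w \<Rightarrow> 'v \<Rightarrow> complex" and l :: "'w \<Rightarrow> real"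
  assumes vs: "distinct vs" and W: "finite W" "card W = length vs"
    and eigen: "\<And>w v. w \<in> W \<Longrightarrow> v \<in> set vs \<Longrightarrow>
      (\<Sum>x\<in>set vs. of_real (A v x) * F w x) = of_real (l w) * F w v"
    and orth: "\<And>w w'. w \<in> W \<Longrightarrow> w' \<in> W \<Longrightarrow> w \<noteq> w' \<Longrightarrow> (\<Sum>x\<in>set vs. cnj (F w x) * F w' x) = 0"
    and nonzero: "\<And>w. w \<in> W \<Longrightarrow> \<exists>x\<in>set vs. F w x \<noteq> 0"
  shows "proots (char_poly (mat (length vs) (length vs) (\<lambda>(i, j). A (vs ! i) (vs ! j)))) = (\<Sum>w\<in>W. {#l w#})"
proof -
  let ?N = "length vs"
  let ?M = "mat ?N ?N (\<lambda>(i, j). A (vs ! i) (vs ! j))"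
  interpret hp: map_poly_inj_comm_ring_hom "of_real :: real \<Rightarrow> complex" ..
  have "map_poly of_real (char_poly ?M) = char_poly (map_mat complex_of_real ?M)"
    by (rule of_real_hom.char_poly_hom[symmetric, of _ ?N]) auto
  also have "map_mat complex_of_real ?M = mat ?N ?N (\<lambda>(i, j). complex_of_real (A (vs ! i) (vs ! j)))"
    by (rule eq_matI) auto
  also have "char_poly \<dots> = (\<Prod>w\<in>W. [:- complex_of_real (l w), 1:])"
    by (rule char_poly_orthogonal_eigenbasis[OF vs W eigen orth nonzero])
  also have "\<dots> = map_poly of_real (\<Prod>w\<in>W. [:- l w, 1:])"
    by (simp add: hp.hom_prod)
  finally have "char_poly ?M = (\<Prod>w\<in>W. [:- l w, 1:])" by (rule hp.injectivity)
  then show ?thesis by (simp add: proots_prod)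
qed

section \<open>The distance matrix\<close>

text \<open>The index of a rotation enters only through equality, as all remaining rotations are
  alike with respect to distance. The difference is taken in \<open>int\<close> to avoid truncated
  subtraction.\<close>

definition dihedral_dist :: "nat \<Rightarrow> nat + nat \<Rightarrow> nat + nat \<Rightarrow> real" where
  "dihedral_dist n x y = (if x = y then 0 else
     case x of
       Inl _ \<Rightarrow> (case y of Inl _ \<Rightarrow> 2 | Inr _ \<Rightarrow> 1)
     | Inr i \<Rightarrow> (case y of Inl _ \<Rightarrow> 1 | Inr j \<Rightarrow> if coprime (int j - int i) (int n) then 1 else 2))"

text \<open>
  \<open>Inl i\<close> stands for the \<open>i\<close>-th rotation \<open>r\<^sup>u\<close> with \<open>u\<close> prime to \<open>n\<close>, and \<open>Inr j\<close> for the reflection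
  \<open>r\<^sup>j s\<close>.
\<close>

definition dihedral_labels :: "nat \<Rightarrow> (nat + nat) set" where
  "dihedral_labels n = {..<totient n} <+> {..<n}"

text \<open>A quarter of the discriminant of the characteristic polynomial of the 2x2 quotient
  matrix, whose half trace is \<open>n - 2 + totient n / 2\<close>.\<close>

definition dihedral_disc :: "nat \<Rightarrow> real" where
  "dihedral_disc n = (real n)\<^sup>2 + (3 * real (totient n) / 2)\<^sup>2 - 2 * real n * real (totient n)"

text \<open>The vertex labels also index the eigenvectors, which makes their number right
  automatically. A positive index is a frequency on its class; the two slots with index 0, where a
  character would be constant, hold the two eigenvectors of the quotient matrix.\<close>

definition dihedral_eigval :: "nat \<Rightarrow> nat + nat \<Rightarrow> real" where
  "dihedral_eigval n w = (case w of
      Inl k \<Rightarrow> if k = 0 then real n - 2 + real (totient n) / 2 + sqrt (dihedral_disc n) else - 2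
    | Inr k \<Rightarrow> if k = 0 then real n - 2 + real (totient n) / 2 - sqrt (dihedral_disc n)
        else - 2 - of_int (moebius_mu (n div gcd k n)) *
               (real (totient n) / real (totient (n div gcd k n))))"

text \<open>
  Eigenvectors constant on rotations and on reflections come from the quotient matrix with rows
  \<open>(2 (\<phi> - 1), n)\<close> and \<open>(\<phi>, 2 (n - 1) - \<phi>)\<close>, where \<open>\<phi>\<close> is \<open>totient n\<close>; the others are characters supported
  on one of the two classes.
\<close>

definition dihedral_eigfun :: "nat \<Rightarrow> nat + nat \<Rightarrow> nat + nat \<Rightarrow> complex" where
  "dihedral_eigfun n w x = (case w of
      Inl k \<Rightarrow> (if k = 0
        then case x of Inl _ \<Rightarrow> of_nat n
          | Inr _ \<Rightarrow> of_real (real n - 3 * real (totient n) / 2 + sqrt (dihedral_disc n))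
        else case x of Inl i \<Rightarrow> unity_root (totient n) ^ (k * i) | Inr _ \<Rightarrow> 0)
    | Inr k \<Rightarrow> (if k = 0
        then case x of Inl _ \<Rightarrow> of_nat n
          | Inr _ \<Rightarrow> of_real (real n - 3 * real (totient n) / 2 - sqrt (dihedral_disc n))
        else case x of Inl _ \<Rightarrow> 0 | Inr i \<Rightarrow> unity_root n ^ (k * i)))"

lemma finite_dihedral_labels [simp]: "finite (dihedral_labels n)"
  by (simp add: dihedral_labels_def)

lemma in_dihedral_labels [simp]:
  "Inl i \<in> dihedral_labels n \<longleftrightarrow> i < totient n"
  "Inr j \<in> dihedral_labels n \<longleftrightarrow> j < n"
  by (auto simp: dihedral_labels_def)

lemma sum_dihedral_labels:
  "sum f (dihedral_labels n) = (\<Sum>i<totient n. f (Inl i)) + (\<Sum>j<n. f (Inr j))"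
  by (simp add: dihedral_labels_def sum.Plus)

text \<open>Completing the square shows that the discriminant is nonnegative, so that squaring
  undoes \<open>sqrt\<close>.\<close>

lemma sqrt_dihedral_disc_square: "(sqrt (dihedral_disc n))\<^sup>2 = dihedral_disc n"
proof -
  have "dihedral_disc n = (real n - real (totient n))\<^sup>2 + 5 / 4 * (real (totient n))\<^sup>2"
    by (simp add: dihedral_disc_def power2_eq_square algebra_simps)
  then show ?thesis by (simp add: zero_le_power2 add_nonneg_nonneg)
qed

text \<open>Translation by \<open>j\<close> modulo \<open>n\<close>: it exposes the circulant form
  of the reflection block, from which a character can be factored out.\<close>

lemma sum_coprime_difference:
  fixes f :: "nat \<Rightarrow> complex"
  assumes "n > 0" "j < n"
  shows "(\<Sum>y | y < n \<and> coprime (int y - int j) (int n). f y) =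
    (\<Sum>y | y < n \<and> coprime y n. f ((j + y) mod n))"
proof -
  have cop: "coprime (int ((j + y) mod n) - int j) (int n) \<longleftrightarrow> coprime y n" for y
  proof -
    have "coprime (int ((j + y) mod n) - int j) (int n) \<longleftrightarrow>
        coprime ((int ((j + y) mod n) - int j) mod int n) (int n)"
      by (simp add: coprime_mod_left_iff assms)
    also have "(int ((j + y) mod n) - int j) mod int n = int y mod int n"
      by (simp add: zmod_int mod_simps)
    also have "coprime (int y mod int n) (int n) \<longleftrightarrow> coprime y n"
      by (simp add: coprime_mod_left_iff assms)
    finally show ?thesis .
  qed
  \<comment> \<open>Adding \<open>n\<close> before subtracting \<open>j\<close> keeps the inverse
    translation within the natural numbers.\<close>
  have inv1: "(j + (y + n - j) mod n) mod n = y" if "y < n" for y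
  proof -
    have "(j + (y + n - j) mod n) mod n = (j + (y + n - j)) mod n" by (simp only: mod_simps)
    then show ?thesis using that assms by simp
  qed
  have inv2: "((j + y) mod n + n - j) mod n = y" if "y < n" for y
  proof -
    have "((j + y) mod n + n - j) mod n = ((j + y) mod n + (n - j)) mod n" using assms by simp
    also have "\<dots> = (j + y + (n - j)) mod n" by (simp only: mod_simps)
    finally show ?thesis using that assms by simp
  qed
  show ?thesis
  proof (rule sum.reindex_bij_witness[of _ "\<lambda>y. (j + y) mod n" "\<lambda>y. (y + n - j) mod n"])
    fix y assume "y \<in> {y. y < n \<and> coprime (int y - int j) (int n)}"
    then have y: "y < n" "coprime (int y - int j) (int n)" by auto
    show "(j + (y + n - j) mod n) mod n = y" by (rule inv1[OF y(1)])
    have "coprime ((y + n - j) mod n) n" using y(2) by (simp only: inv1[OF y(1)] flip: cop)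
    then show "(y + n - j) mod n \<in> {y. y < n \<and> coprime y n}" using assms by simp
    show "f ((j + (y + n - j) mod n) mod n) = f y" by (simp only: inv1[OF y(1)])
  next
    fix y assume "y \<in> {y. y < n \<and> coprime y n}"
    then have y: "y < n" "coprime y n" by auto
    show "((j + y) mod n + n - j) mod n = y" by (rule inv2[OF y(1)])
    show "(j + y) mod n \<in> {y. y < n \<and> coprime (int y - int j) (int n)}"
      using y(2) assms unfolding mem_Collect_eq cop by simp
  qed
qed

text \<open>\<open>totatives n\<close> lives in \<open>{0<..n}\<close> and the residues here in
  \<open>{0..<n}\<close>; for \<open>n \<ge> 2\<close> neither 0 nor \<open>n\<close> is prime to
  \<open>n\<close>.\<close>

lemma card_coprime_less:
  assumes "n \<ge> 2"
  shows "card {y. y < n \<and> coprime y n} = totient n"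
proof -
  have "{y. y < n \<and> coprime y n} = totatives n"
    using assms by (auto simp: totatives_def le_less intro!: Nat.gr0I)
  then show ?thesis by (simp add: totient_def)
qed

text \<open>With \<open>J\<close> all ones and \<open>A\<close> the adjacency matrix of the
  reflections, the diagonal blocks are \<open>2J - 2I\<close> and \<open>2J - 2I - A\<close>, and
  the off-diagonal blocks are \<open>J\<close>.\<close>

lemma sum_dihedral_dist:
  fixes f :: "nat + nat \<Rightarrow> complex"
  assumes n: "n \<ge> 2"
  shows "i < totient n \<Longrightarrow> (\<Sum>x\<in>dihedral_labels n. of_real (dihedral_dist n (Inl i) x) * f x) =
      2 * (\<Sum>i<totient n. f (Inl i)) - 2 * f (Inl i) + (\<Sum>j<n. f (Inr j))"
    and "j < n \<Longrightarrow> (\<Sum>x\<in>dihedral_labels n. of_real (dihedral_dist n (Inr j) x) * f x) =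
      (\<Sum>i<totient n. f (Inl i)) + 2 * (\<Sum>j<n. f (Inr j)) - 2 * f (Inr j)
      - (\<Sum>y | y < n \<and> coprime y n. f (Inr ((j + y) mod n)))"
proof -
  assume i: "i < totient n"
  have "(\<Sum>k<totient n. of_real (dihedral_dist n (Inl i) (Inl k)) * f (Inl k)) =
    (\<Sum>k<totient n. 2 * f (Inl k) - (if k = i then 2 * f (Inl i) else 0))"
    by (rule sum.cong) (auto simp: dihedral_dist_def)
  also have "\<dots> = 2 * (\<Sum>k<totient n. f (Inl k)) - 2 * f (Inl i)"
    using i by (simp add: sum_subtractf sum_distrib_left)
  finally show "(\<Sum>x\<in>dihedral_labels n. of_real (dihedral_dist n (Inl i) x) * f x) =
      2 * (\<Sum>i<totient n. f (Inl i)) - 2 * f (Inl i) + (\<Sum>j<n. f (Inr j))"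
    by (simp add: sum_dihedral_labels) (simp add: dihedral_dist_def)
next
  assume j: "j < n"
  \<comment> \<open>The correction for adjacency must not touch the diagonal, where the entry has
    already been lowered from 2 to 0.\<close>
  have nc: "\<not> coprime (int j - int j) (int n)" using n by simp
  have "(\<Sum>k<n. of_real (dihedral_dist n (Inr j) (Inr k)) * f (Inr k)) =
    (\<Sum>k<n. 2 * f (Inr k) - (if k = j then 2 * f (Inr j) else 0)
        - (if coprime (int k - int j) (int n) then f (Inr k) else 0))"
    by (rule sum.cong) (use nc in \<open>auto simp: dihedral_dist_def\<close>)
  also have "\<dots> = 2 * (\<Sum>k<n. f (Inr k)) - 2 * f (Inr j)
       - (\<Sum>k<n. if coprime (int k - int j) (int n) then f (Inr k) else 0)"
    using j by (simp add: sum_subtractf sum_distrib_left)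
  also have "(\<Sum>k<n. if coprime (int k - int j) (int n) then f (Inr k) else 0) =
      (\<Sum>k | k < n \<and> coprime (int k - int j) (int n). f (Inr k))"
    by (rule sum.mono_neutral_cong_right) auto
  also have "\<dots> = (\<Sum>y | y < n \<and> coprime y n. f (Inr ((j + y) mod n)))"
    using n j by (intro sum_coprime_difference[of n j "\<lambda>x. f (Inr x)"]) auto
  finally show "(\<Sum>x\<in>dihedral_labels n. of_real (dihedral_dist n (Inr j) x) * f x) =
      (\<Sum>i<totient n. f (Inl i)) + 2 * (\<Sum>j<n. f (Inr j)) - 2 * f (Inr j)
      - (\<Sum>y | y < n \<and> coprime y n. f (Inr ((j + y) mod n)))"
    by (simp add: sum_dihedral_labels) (simp add: dihedral_dist_def)
qed

section \<open>Eigenvectors of the distance matrix\<close>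

lemma sum_unity_root_powers_eq_0:
  assumes "0 < k" "k < m"
  shows "(\<Sum>i<m. unity_root m ^ (k * i)) = 0" "(\<Sum>i<m. cnj (unity_root m ^ (k * i))) = 0"
proof -
  show *: "(\<Sum>i<m. unity_root m ^ (k * i)) = 0"
    using assms sum_unity_root_powers[of m k] by (auto dest: dvd_imp_le)
  show "(\<Sum>i<m. cnj (unity_root m ^ (k * i))) = 0"
    using arg_cong[OF *, of cnj] by simp
qed

text \<open>\<open>(n, b)\<close> is an eigenvector of the quotient matrix for the eigenvalue
  \<open>e\<close>: the first row dictates \<open>b = e - 2 * (\<phi> - 1)\<close>, and the second
  is then the characteristic equation. Leaving \<open>q\<close> an arbitrary square root treats both
  signs at once.\<close>

lemma quotient_eigval:
  fixes n \<phi> q :: real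
  assumes "q\<^sup>2 = n\<^sup>2 + (3 * \<phi> / 2)\<^sup>2 - 2 * n * \<phi>"
  defines "b \<equiv> n - 3 * \<phi> / 2 + q" and "e \<equiv> n - 2 + \<phi> / 2 + q"
  shows "2 * \<phi> * n - 2 * n + n * b = e * n"
    and "\<phi> * n + 2 * n * b - 2 * b - \<phi> * b = e * b"
  using assms(1) by (simp_all add: b_def e_def power2_eq_square algebra_simps add_divide_distrib)

lemma dihedral_constant_eigfun:
  fixes q :: real
  assumes n: "n \<ge> 2" and q: "q\<^sup>2 = dihedral_disc n"
    and F: "\<And>i. F (Inl i) = complex_of_nat n"
      "\<And>j. F (Inr j) = complex_of_real (real n - 3 * real (totient n) / 2 + q)"
    and v: "v \<in> dihedral_labels n"
  shows "(\<Sum>x\<in>dihedral_labels n. of_real (dihedral_dist n v x) * F x) =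
    of_real (real n - 2 + real (totient n) / 2 + q) * F v"
proof -
  note E = quotient_eigval[OF q[unfolded dihedral_disc_def], THEN arg_cong[where f = complex_of_real]]
  show ?thesis
  proof (cases v)
    case (Inl i)
    then have "i < totient n" using v by (auto simp: dihedral_labels_def)
    with E(1) show ?thesis by (simp add: Inl F sum_dihedral_dist(1)[OF n] mult.assoc)
  next
    case (Inr j)
    then have "j < n" using v by (auto simp: dihedral_labels_def)
    with E(2) show ?thesis
      by (simp add: Inr F sum_dihedral_dist(2)[OF n] card_coprime_less[OF n] mult.assoc)
  qed
qed

lemma dihedral_eigfun_eigen:
  assumes n: "n \<ge> 2" and w: "w \<in> dihedral_labels n" and v: "v \<in> dihedral_labels n"
  shows "(\<Sum>x\<in>dihedral_labels n. of_real (dihedral_dist n v x) * dihedral_eigfun n w x) =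
    of_real (dihedral_eigval n w) * dihedral_eigfun n w v"
proof -
  consider "w = Inl 0" | "w = Inr 0" | k where "w = Inl k" "0 < k" "k < totient n"
    | k where "w = Inr k" "0 < k" "k < n"
    using w by (auto simp: dihedral_labels_def)
  then show ?thesis
  proof cases
    case 1
    have "(\<Sum>x\<in>dihedral_labels n. of_real (dihedral_dist n v x) * dihedral_eigfun n w x) =
      of_real (real n - 2 + real (totient n) / 2 + sqrt (dihedral_disc n)) * dihedral_eigfun n w v"
      by (rule dihedral_constant_eigfun[OF n sqrt_dihedral_disc_square _ _ v])
        (simp_all add: 1 dihedral_eigfun_def)
    then show ?thesis by (simp add: 1 dihedral_eigval_def)
  next
    case 2
    have "(\<Sum>x\<in>dihedral_labels n. of_real (dihedral_dist n v x) * dihedral_eigfun n w x) =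
      of_real (real n - 2 + real (totient n) / 2 + (- sqrt (dihedral_disc n))) * dihedral_eigfun n w v"
      by (rule dihedral_constant_eigfun[OF n _ _ _ v])
        (simp_all add: 2 dihedral_eigfun_def sqrt_dihedral_disc_square)
    then show ?thesis by (simp add: 2 dihedral_eigval_def)
  next
    case (3 k)
    then have F: "dihedral_eigfun n w (Inl i) = unity_root (totient n) ^ (k * i)"
      "dihedral_eigfun n w (Inr i) = 0" for i
      by (simp_all add: dihedral_eigfun_def)
    \<comment> \<open>A nonzero frequency sums to zero, which kills every all-ones block; of the row
      only \<open>-2\<close> times the identity survives.\<close>
    note S = sum_unity_root_powers_eq_0(1)[OF 3(2,3)]
    show ?thesis
    proof (cases v)
      case (Inl i)
      then have "i < totient n" using v by (auto simp: dihedral_labels_def)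
      moreover have "dihedral_eigval n w = - 2" using 3 by (simp add: dihedral_eigval_def)
      ultimately show ?thesis by (simp add: Inl sum_dihedral_dist(1)[OF n] F S)
    next
      case (Inr j)
      then have "j < n" using v by (auto simp: dihedral_labels_def)
      then show ?thesis by (simp add: Inr sum_dihedral_dist(2)[OF n] F S)
    qed
  next
    case (4 k)
    then have F: "dihedral_eigfun n w (Inr i) = unity_root n ^ (k * i)"
      "dihedral_eigfun n w (Inl i) = 0" for i
      by (simp_all add: dihedral_eigfun_def)
    note S = sum_unity_root_powers_eq_0(1)[OF 4(2,3)]
    show ?thesis
    proof (cases v)
      case (Inl i)
      then have "i < totient n" using v by (auto simp: dihedral_labels_def)
      then show ?thesis by (simp add: Inl sum_dihedral_dist(1)[OF n] F S)
    next
      case (Inr j)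
      then have j: "j < n" using v by (auto simp: dihedral_labels_def)
      define c where "c = of_int (moebius_mu (n div gcd k n)) *
               (real (totient n) / real (totient (n div gcd k n)))"
      have "unity_root n ^ (k * ((j + y) mod n)) = unity_root n ^ (k * j) * unity_root n ^ (k * y)" for y
      proof -
        have "unity_root n ^ (k * ((j + y) mod n)) = (unity_root n ^ ((j + y) mod n)) ^ k"
          by (simp add: mult.commute flip: power_mult)
        also have "\<dots> = unity_root n ^ ((j + y) * k)"
          using n by (simp add: unity_root_power_mod power_mult)
        also have "\<dots> = unity_root n ^ (k * j) * unity_root n ^ (k * y)"
          by (simp add: algebra_simps flip: power_add)
        finally show ?thesis .
      qed
      \<comment> \<open>The character value at \<open>j\<close> comes out of the translated sum, and
        what remains is the Ramanujan sum.\<close>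
      then have R: "(\<Sum>y | y < n \<and> coprime y n. unity_root n ^ (k * ((j + y) mod n))) =
        unity_root n ^ (k * j) * of_real c"
        using ramanujan_sum[of n k] n by (simp add: c_def flip: sum_distrib_left)
      have "dihedral_eigval n w = - 2 - c"
        using 4 by (simp add: dihedral_eigval_def c_def)
      then show ?thesis
        by (simp add: Inr sum_dihedral_dist(2)[OF n j] F S R left_diff_distrib mult.commute[of "of_real c"])
    qed
  qed
qed

text \<open>Characters on different classes have disjoint supports, those on one class are
  orthogonal, and a nontrivial one sums to zero against constants. Only the two vectors of the
  quotient problem need a computation.\<close>

lemma dihedral_eigfun_orthogonal:
  assumes n: "n \<ge> 2" and w: "w \<in> dihedral_labels n" "w' \<in> dihedral_labels n" "w \<noteq> w'"
  shows "(\<Sum>x\<in>dihedral_labels n. cnj (dihedral_eigfun n w x) * dihedral_eigfun n w' x) = 0"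
proof -
  define b where "b q = real n - 3 * real (totient n) / 2 + q" for q
  let ?q = "sqrt (dihedral_disc n)"
  \<comment> \<open>The classes have sizes \<open>totient n\<close> and \<open>n\<close>, so the
    inner product of the two vectors is \<open>totient n * n^2 + n * b ?q * b (- ?q)\<close>; it
    vanishes because the product of the \<open>b\<close> values is
    \<open>- totient n * n\<close>.\<close>
  have "b ?q * b (- ?q) = (real n - 3 * real (totient n) / 2)\<^sup>2 - dihedral_disc n"
    using sqrt_dihedral_disc_square[of n] by (simp add: b_def power2_eq_square algebra_simps)
  also have "\<dots> = - real (totient n) * real n"
    by (simp add: dihedral_disc_def power2_eq_square algebra_simps)
  finally have "real (totient n) * (real n * real n) + real n * (b ?q * b (- ?q)) = 0" by simp
  from arg_cong[OF this, of complex_of_real]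
  have bb: "of_nat (totient n) * (of_nat n * of_nat n) +
      of_nat n * (complex_of_real (b ?q) * complex_of_real (b (- ?q))) = 0"
    by simp
  have F: "dihedral_eigfun n (Inl 0) x = (case x of Inl _ \<Rightarrow> of_nat n | Inr _ \<Rightarrow> of_real (b ?q))"
    "dihedral_eigfun n (Inr 0) x = (case x of Inl _ \<Rightarrow> of_nat n | Inr _ \<Rightarrow> of_real (b (- ?q)))"
    "k > 0 \<Longrightarrow> dihedral_eigfun n (Inl k) x =
      (case x of Inl i \<Rightarrow> unity_root (totient n) ^ (k * i) | Inr _ \<Rightarrow> 0)"
    "k > 0 \<Longrightarrow> dihedral_eigfun n (Inr k) x =
      (case x of Inl _ \<Rightarrow> 0 | Inr i \<Rightarrow> unity_root n ^ (k * i))" for k x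
    by (simp_all add: dihedral_eigfun_def b_def split: sum.split)
  have cases: "w = Inl 0 \<or> w = Inr 0 \<or> (\<exists>k. w = Inl k \<and> 0 < k \<and> k < totient n)
      \<or> (\<exists>k. w = Inr k \<and> 0 < k \<and> k < n)" if "w \<in> dihedral_labels n" for w
    using that by (auto simp: dihedral_labels_def)
  note S = sum_unity_root_powers_eq_0
  show ?thesis
  proof (cases "w \<in> {Inl 0, Inr 0} \<and> w' \<in> {Inl 0, Inr 0}")
    case True
    then consider "w = Inl 0" "w' = Inr 0" | "w = Inr 0" "w' = Inl 0" using w(3) by auto
    then show ?thesis
      by cases (use bb in \<open>simp_all add: sum_dihedral_labels F mult.commute[of "complex_of_real (b (- ?q))"]\<close>)
  next
    case False
    with cases[OF w(1)] cases[OF w(2)] w(3) show ?thesis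
      \<comment> \<open>\<open>complex_cnj_power\<close> would move the conjugation to the base,
        away from the form in which the character sums are stated.\<close>
      by (elim disjE exE conjE;
        simp add: sum_dihedral_labels F S sum_cnj_unity_root_powers
          flip: sum_distrib_left sum_distrib_right del: complex_cnj_power)
  qed
qed

lemma dihedral_eigfun_nonzero:
  assumes n: "n \<ge> 2" and w: "w \<in> dihedral_labels n"
  shows "\<exists>x\<in>dihedral_labels n. dihedral_eigfun n w x \<noteq> 0"
proof -
  have t: "totient n > 0" using n by simp
  show ?thesis
  proof (cases "\<exists>k. w = Inr k \<and> k > 0")
    case True
    then show ?thesis using n by (intro bexI[of _ "Inr 0"]) (auto simp: dihedral_eigfun_def dihedral_labels_def)
  next
    case False
    then show ?thesis using n t
      by (intro bexI[of _ "Inl 0"]) (auto simp: dihedral_eigfun_def dihedral_labels_def split: sum.split)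
  qed
qed

lemma proots_char_poly_dihedral_dist:
  assumes n: "n \<ge> 2" and vs: "distinct vs" "set vs = dihedral_labels n"
  shows "proots (char_poly (mat (length vs) (length vs) (\<lambda>(i, j). dihedral_dist n (vs ! i) (vs ! j)))) =
    (\<Sum>w\<in>dihedral_labels n. {#dihedral_eigval n w#})"
  using dihedral_eigfun_eigen[OF n] dihedral_eigfun_orthogonal[OF n] dihedral_eigfun_nonzero[OF n]
    distinct_card[OF vs(1)] vs
  by (intro proots_char_poly_orthogonal_eigenbasis[where F = "dihedral_eigfun n"]) auto

lemma dihedral_eigval_mset:
  assumes n: "n \<ge> 2"
  defines "n0 \<equiv> \<Prod>(prime_factors n)"
  shows "(\<Sum>w\<in>dihedral_labels n. {#dihedral_eigval n w#}) =
    replicate_mset (totient n + n - n0 - 1) (- 2)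
     + (\<Sum>t\<in>{t. t dvd n0} - {1}. replicate_mset (totient t)
          (- 2 - of_int (moebius_mu t) * (real (totient n) / real (totient t))))
     + {# real n - 2 + real (totient n) / 2 + sqrt (dihedral_disc n),
          real n - 2 + real (totient n) / 2 - sqrt (dihedral_disc n) #}"
proof -
  have t: "totient n > 0" using n by simp
  have "n0 dvd n" unfolding n0_def by (subst prod_primes_dvd_iff) auto
  then have n0: "n0 \<le> n" using n by (intro dvd_imp_le) auto
  have "(\<Sum>i<totient n. {#dihedral_eigval n (Inl i)#}) =
    {#dihedral_eigval n (Inl 0)#} + (\<Sum>i\<in>{0<..<totient n}. {#dihedral_eigval n (Inl i)#})"
  proof -
    have "{..<totient n} = insert 0 {0<..<totient n}" using t by auto
    then show ?thesis by simp
  qed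
  also have "(\<Sum>i\<in>{0<..<totient n}. {#dihedral_eigval n (Inl i)#}) = (\<Sum>i\<in>{0<..<totient n}. {#- 2#})"
    by (rule sum.cong) (auto simp: dihedral_eigval_def)
  also have "\<dots> = replicate_mset (totient n - 1) (- 2)" by (simp add: sum_singleton_mset_const)
  finally have L: "(\<Sum>i<totient n. {#dihedral_eigval n (Inl i)#}) =
    {#dihedral_eigval n (Inl 0)#} + replicate_mset (totient n - 1) (- 2)" .
  have "(\<Sum>i<n. {#dihedral_eigval n (Inr i)#}) =
    {#dihedral_eigval n (Inr 0)#} + (\<Sum>i\<in>{0<..<n}. {#dihedral_eigval n (Inr i)#})"
  proof -
    have "{..<n} = insert 0 {0<..<n}" using n by auto
    then show ?thesis by simp
  qed
  also have "(\<Sum>i\<in>{0<..<n}. {#dihedral_eigval n (Inr i)#}) =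
      (\<Sum>i\<in>{0<..<n}. {#- 2 - of_int (moebius_mu (n div gcd i n)) *
               (real (totient n) / real (totient (n div gcd i n)))#})"
    by (rule sum.cong) (auto simp: dihedral_eigval_def)
  also have "\<dots> = replicate_mset (n - n0) (- 2) + (\<Sum>t\<in>{t. t dvd n0} - {1}. replicate_mset (totient t)
          (- 2 - of_int (moebius_mu t) * (real (totient n) / real (totient t))))"
    unfolding n0_def using n by (intro ramanujan_sum_mset) simp
  finally have R: "(\<Sum>i<n. {#dihedral_eigval n (Inr i)#}) = {#dihedral_eigval n (Inr 0)#} +
    (replicate_mset (n - n0) (- 2) + (\<Sum>t\<in>{t. t dvd n0} - {1}. replicate_mset (totient t)
          (- 2 - of_int (moebius_mu t) * (real (totient n) / real (totient t)))))" .
  \<comment> \<open>The two sources of \<open>-2\<close> are the nonzero frequencies on rotations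
    and the non-squarefree orders on reflections; \<open>n0 \<le> n\<close> and
    \<open>totient n > 0\<close> make the truncated subtractions exact.\<close>
  have "totient n + n - n0 - 1 = (totient n - 1) + (n - n0)" using t n0 by linarith
  then have "replicate_mset (totient n + n - n0 - 1) (- 2 :: real) =
      replicate_mset (totient n - 1) (- 2) + replicate_mset (n - n0) (- 2)"
    by (simp only:) (rule multiset_eqI, simp)
  then show ?thesis
    unfolding sum_dihedral_labels L R by (simp add: dihedral_eigval_def)
qed

section \<open>Generating pairs of dihedral groups\<close>

context dihedral_group
begin

text \<open>Normal form with an unreduced integer exponent: products and inverses then follow sign
  rules alone, and reduction modulo \<open>n\<close> is kept apart in
  \<open>element_mod\<close>.\<close>

definition element :: "int \<Rightarrow> bool \<Rightarrow> 'a" where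
  "element i a = r [^] i \<otimes> (if a then s else \<one>)"

lemma element_closed [simp]: "element i a \<in> carrier G"
  using r_carrier s_carrier by (simp add: element_def)

lemma s_square: "s \<otimes> s = \<one>"
  using s_pow s_carrier by (simp add: numeral_2_eq_2)

lemma s_int_pow_r: "s \<otimes> r [^] (i::int) = r [^] (- i) \<otimes> s"
proof -
  note [simp] = r_carrier s_carrier
  have cancel: "s \<otimes> (s \<otimes> x) = x" if "x \<in> carrier G" for x
    using that by (simp add: s_square flip: m_assoc)
  have sr: "s \<otimes> r = inv r \<otimes> s"
  proof -
    have "s \<otimes> r = s \<otimes> r \<otimes> s \<otimes> s" by (simp add: m_assoc s_square)
    then show ?thesis by (simp only: conj)
  qed
  have sr': "s \<otimes> inv r = r \<otimes> s"
  proof -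
    have "s \<otimes> inv r = s \<otimes> (s \<otimes> r \<otimes> s)" by (simp only: conj)
    then show ?thesis by (simp add: m_assoc cancel)
  qed
  \<comment> \<open>Stated for any \<open>x\<close>, \<open>y\<close> with
    \<open>s \<otimes> x = y \<otimes> s\<close>, so that one induction serves both signs of the
    exponent.\<close>
  have nat: "s \<otimes> x [^] (m::nat) = y [^] m \<otimes> s"
    if "x \<in> carrier G" "y \<in> carrier G" "s \<otimes> x = y \<otimes> s" for x y m
  proof (induction m)
    case (Suc m)
    have "s \<otimes> x [^] Suc m = y [^] m \<otimes> (s \<otimes> x)"
      using that(1,2) Suc by (simp add: m_assoc flip: m_assoc[of s])
    also have "\<dots> = y [^] Suc m \<otimes> s" using that by (simp add: m_assoc)
    finally show ?case .
  qed simp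
  show ?thesis
  proof (cases i rule: int_cases2)
    case (nonneg m)
    then show ?thesis using nat[OF _ _ sr, of m] by (simp add: int_pow_neg int_pow_int nat_pow_inv)
  next
    case (nonpos m)
    then show ?thesis using nat[OF _ _ sr', of m] by (simp add: int_pow_neg int_pow_int nat_pow_inv)
  qed
qed

lemma element_mult:
  "element i a \<otimes> element j b = element (if a then i - j else i + j) (a \<noteq> b)"
proof -
  note [simp] = r_carrier s_carrier
  have *: "r [^] i \<otimes> s \<otimes> (r [^] j \<otimes> x) = r [^] (i - j) \<otimes> (s \<otimes> x)" if "x \<in> carrier G" for x
  proof -
    have "r [^] i \<otimes> s \<otimes> (r [^] j \<otimes> x) = r [^] i \<otimes> (s \<otimes> r [^] j) \<otimes> x"
      using that by (simp add: m_assoc)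
    also have "\<dots> = r [^] i \<otimes> r [^] (- j) \<otimes> (s \<otimes> x)"
      using that by (simp add: s_int_pow_r m_assoc)
    also have "r [^] i \<otimes> r [^] (- j) = r [^] (i - j)" by (simp flip: int_pow_mult)
    finally show ?thesis .
  qed
  show ?thesis
  proof (cases a)
    case True
    have "element i True \<otimes> element j b = r [^] (i - j) \<otimes> (s \<otimes> (if b then s else \<one>))"
      unfolding element_def if_True by (rule *) simp
    then show ?thesis using True by (cases b) (simp_all add: element_def s_square)
  next
    case False
    then show ?thesis by (cases b) (simp_all add: element_def int_pow_mult m_assoc)
  qed
qed

lemma element_0_False: "element 0 False = \<one>"
  by (simp add: element_def)

lemma element_1_False: "element 1 False = r" and element_0_True: "element 0 True = s"
  using r_carrier s_carrier by (simp_all add: element_def)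

lemma inv_element: "inv (element i a) = element (if a then i else - i) a"
  by (rule inv_equality) (auto simp: element_mult element_0_False)

lemma carrier_eq_elements: "carrier G = {element i a | i a. True}"
proof
  have "subgroup {element i a | i a. True} G"
    by (rule subgroupI) (auto simp: inv_element element_mult, blast+)
  moreover have "{r, s} \<subseteq> {element i a | i a. True}"
    using element_1_False[symmetric] element_0_True[symmetric] by blast
  ultimately show "carrier G \<subseteq> {element i a | i a. True}"
    using generate_subgroup_incl generators by metis
qed auto

lemma element_mod: "element (i mod int n) a = element i a"
proof -
  have "r [^] i = r [^] (int n * (i div int n) + i mod int n)" by simp
  also have "\<dots> = (r [^] int n) [^] (i div int n) \<otimes> r [^] (i mod int n)"
    using r_carrier by (simp only: int_pow_mult int_pow_pow)
  also have "\<dots> = r [^] (i mod int n)" using r_carrier r_pow by (simp add: int_pow_int)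
  finally show ?thesis by (simp add: element_def)
qed

text \<open>Here the order of the group enters: the \<open>2 * n\<close> reduced normal forms cover
  a group of \<open>2 * n\<close> elements, so no two of them coincide.\<close>

lemma element_eq_iff:
  assumes "n > 0"
  shows "element i a = element j b \<longleftrightarrow> i mod int n = j mod int n \<and> a = b"
proof -
  let ?f = "\<lambda>(i, a). element i a" and ?A = "{0..<int n} \<times> (UNIV :: bool set)"
  have "?f ` ?A = carrier G"
  proof
    show "carrier G \<subseteq> ?f ` ?A"
    proof
      fix x assume "x \<in> carrier G"
      then obtain i a where "x = element i a" using carrier_eq_elements by auto
      then have "x = ?f (i mod int n, a)" by (simp add: element_mod)
      then show "x \<in> ?f ` ?A" using assms by (intro image_eqI[of _ _ "(i mod int n, a)"]) auto
    qed
  qed auto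
  then have "card (?f ` ?A) = card ?A"
    using order_eq by (simp add: Coset.order_def card_cartesian_product)
  then have inj: "inj_on ?f ?A" by (intro eq_card_imp_inj_on) auto
  show ?thesis
  proof
    assume "element i a = element j b"
    then have "?f (i mod int n, a) = ?f (j mod int n, b)" by (simp add: element_mod)
    then have "(i mod int n, a) = (j mod int n, b)"
      using assms by (intro inj_onD[OF inj]) auto
    then show "i mod int n = j mod int n \<and> a = b" by simp
  next
    assume "i mod int n = j mod int n \<and> a = b"
    then have "element (i mod int n) a = element (j mod int n) b" by simp
    then show "element i a = element j b" by (simp only: element_mod)
  qed
qed

lemma generate_rotation_reflection:
  assumes n: "n > 0"
  shows "generate G {element i False, element j True} = carrier G \<longleftrightarrow> coprime i (int n)"
proof
  let ?S = "generate G {element i False, element j True}"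
  have S: "subgroup ?S G" by (rule generate_is_subgroup) auto
  have in_S: "element i False \<in> ?S" "element j True \<in> ?S" by (auto intro: generate.incl)
  {
    assume "coprime i (int n)"
    \<comment> \<open>Bezout makes \<open>r\<close> the \<open>u\<close>-th power of
      \<open>element i False\<close>; then \<open>r\<close> to the power \<open>- j\<close> times
      \<open>element j True\<close> is \<open>s\<close>.\<close>
    then obtain u v where uv: "u * i + v * int n = 1" by (metis bezout_int coprime_imp_gcd_eq_1)
    have "element (i * u) False = element i False [^] u"
      using r_carrier by (simp add: element_def int_pow_pow)
    also have "\<dots> \<in> ?S" by (rule subgroup_int_pow_closed[OF S in_S(1)])
    finally have "element (i * u) False \<in> ?S" .
    also have "i * u = 1 + int n * (- v)" using uv by (simp add: algebra_simps)
    also have "element (1 + int n * (- v)) False = element ((1 + int n * (- v)) mod int n) False"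
      by (simp only: element_mod)
    also have "(1 + int n * (- v)) mod int n = 1 mod int n" by (rule mod_mult_self2)
    also have "element (1 mod int n) False = r" by (simp only: element_mod element_1_False)
    finally have rS: "r \<in> ?S" .
    have "element (- j) False = r [^] (- j)" using r_carrier by (simp add: element_def)
    also have "\<dots> \<in> ?S" by (rule subgroup_int_pow_closed[OF S rS])
    finally have "element (- j) False \<otimes> element j True \<in> ?S"
      using in_S by (intro generate.eng)
    then have "s \<in> ?S" by (simp add: element_mult element_0_True)
    with rS have "carrier G \<subseteq> ?S" unfolding generators[symmetric]
      by (intro generate_subgroup_incl S) auto
    then show "?S = carrier G" using generate_incl[of "{element i False, element j True}"] by auto
  }
  {
    assume gen: "?S = carrier G"
    define g where "g = gcd i (int n)"
    \<comment> \<open>the subgroup generated by \<open>r\<^sup>g\<close> and \<open>r\<^sup>j s\<close>, which is proper unless \<open>g = 1\<close>\<close>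
    define M where "M = {element k a | k a. g dvd k - (if a then j else 0)}"
    have "subgroup M G"
    proof (rule subgroupI)
      have "element 0 False \<in> M" unfolding M_def by force
      then show "M \<noteq> {}" by auto
    next
      fix x assume "x \<in> M"
      then obtain k a where k: "x = element k a" "g dvd k - (if a then j else 0)" by (auto simp: M_def)
      then show "inv x \<in> M" unfolding M_def mem_Collect_eq inv_element k(1)
        by (intro exI[of _ "if a then k else - k"] exI[of _ a]) auto
    next
      fix x y assume "x \<in> M" "y \<in> M"
      then obtain k a l b where k: "x = element k a" "g dvd k - (if a then j else 0)"
          "y = element l b" "g dvd l - (if b then j else 0)" by (auto simp: M_def)
      have "g dvd (if a then k - l else k + l) - (if a \<noteq> b then j else 0)"
      proof (cases a)
        case True
        then show ?thesis using dvd_diff[OF k(2,4)] by (cases b) (auto simp: algebra_simps)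
      next
        case False
        then show ?thesis using dvd_add[OF k(2,4)] by (cases b) (auto simp: algebra_simps)
      qed
      then show "x \<otimes> y \<in> M" unfolding k element_mult M_def by blast
    qed (auto simp: M_def)
    moreover have "{element i False, element j True} \<subseteq> M" unfolding M_def g_def by force
    ultimately have "?S \<subseteq> M" by (rule generate_subgroup_incl[rotated])
    then have "element 1 False \<in> M" using gen by auto
    \<comment> \<open>Membership of \<open>r\<close> in \<open>M\<close> gives an exponent that is 1
      only modulo \<open>n\<close>; since \<open>g\<close> divides \<open>n\<close>, divisibility by
      \<open>g\<close> survives the reduction.\<close>
    then obtain k a where "element 1 False = element k a" "g dvd k - (if a then j else 0)"
      unfolding M_def by auto
    then have k: "1 mod int n = k mod int n" "g dvd k" using n by (auto simp: element_eq_iff split: if_splits)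
    have "g dvd int n" by (simp add: g_def)
    then have "g dvd k mod int n" using k(2) by (simp add: dvd_mod)
    then have "g dvd 1 mod int n" by (simp only: k(1))
    then have "g dvd 1" using \<open>g dvd int n\<close> by (simp add: dvd_mod_iff)
    then show "coprime i (int n)" by (simp add: g_def coprime_iff_gcd_eq_1)
  }
qed

text \<open>The product of the two reflections is the rotation by \<open>i - j\<close>; replacing
  the first reflection by it does not change the generated subgroup.\<close>

lemma generate_two_reflections:
  assumes n: "n > 0"
  shows "generate G {element i True, element j True} = carrier G \<longleftrightarrow> coprime (i - j) (int n)"
proof -
  let ?S = "generate G {element i True, element j True}"
  let ?T = "generate G {element (i - j) False, element j True}"
  have S: "subgroup ?S G" and T: "subgroup ?T G" by (auto intro!: generate_is_subgroup)
  have "element i True \<otimes> element j True \<in> ?S" by (auto intro: generate.incl generate.eng)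
  then have "element (i - j) False \<in> ?S" by (simp add: element_mult)
  then have "?T \<subseteq> ?S" by (intro generate_subgroup_incl S) (auto intro: generate.incl)
  moreover have "element (i - j) False \<otimes> element j True \<in> ?T" by (auto intro: generate.incl generate.eng)
  then have "element i True \<in> ?T" by (simp add: element_mult)
  then have "?S \<subseteq> ?T" by (intro generate_subgroup_incl T) (auto intro: generate.incl)
  ultimately have "?S = ?T" by blast
  then show ?thesis using generate_rotation_reflection[OF n] by simp
qed

lemma generate_two_rotations:
  assumes n: "n > 0"
  shows "generate G {element i False, element j False} \<noteq> carrier G"
proof
  let ?R = "{element k False | k. True}"
  assume gen: "generate G {element i False, element j False} = carrier G"
  have "subgroup ?R G" by (rule subgroupI) (auto simp: inv_element element_mult)
  then have "carrier G \<subseteq> ?R" unfolding gen[symmetric] by (intro generate_subgroup_incl) auto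
  moreover have "element 0 True \<in> carrier G" by simp
  ultimately obtain k where "element 0 True = element k False" by blast
  then show False using n by (simp add: element_eq_iff)
qed

end

section \<open>Distances in the generating graph\<close>

context wf_digraph
begin

lemma awalk_cost_unit: "awalk_cost (\<lambda>_. 1) p = real (length p)"
  by (induction p) auto

lemma unit_distance_le: "awalk u p v \<Longrightarrow> \<mu> (\<lambda>_. 1) u v \<le> ereal (real (length p))"
  using min_cost_le_walk_cost[of u p v "\<lambda>_. 1"] by (simp add: awalk_cost_unit)

lemma unit_distance_ge:
  "(\<And>p. awalk u p v \<Longrightarrow> k \<le> length p) \<Longrightarrow> ereal (real k) \<le> \<mu> (\<lambda>_. 1) u v"
  unfolding \<mu>_def by (rule INF_greatest) (simp add: awalk_cost_unit)

lemma unit_distance_eq: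
  assumes "awalk u p v" "\<And>q. awalk u q v \<Longrightarrow> length p \<le> length q"
  shows "\<mu> (\<lambda>_. 1) u v = ereal (real (length p))"
  using assms by (intro antisym unit_distance_le unit_distance_ge)

lemma unit_distance_refl: "u \<in> verts G \<Longrightarrow> \<mu> (\<lambda>_. 1) u u = 0"
  using unit_distance_eq[of u "[]" u] by (simp add: awalk_Nil_iff zero_ereal_def)

lemma unit_distance_arc:
  assumes "e \<in> arcs G" "tail G e = u" "head G e = v" "u \<noteq> v"
  shows "\<mu> (\<lambda>_. 1) u v = 1"
proof -
  have "awalk u [e] v" using assms by (auto simp: awalk_simps)
  moreover have "length [e] \<le> length q" if "awalk u q v" for q
    using that assms(4) by (cases q) (auto simp: awalk_simps)
  ultimately show ?thesis using unit_distance_eq[of u "[e]" v] by (simp add: one_ereal_def)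
qed

lemma unit_distance_two:
  assumes "e \<in> arcs G" "tail G e = u" "head G e = w"
    and "f \<in> arcs G" "tail G f = w" "head G f = v"
    and "u \<noteq> v" "\<not> u \<rightarrow> v"
  shows "\<mu> (\<lambda>_. 1) u v = 2"
proof -
  have "awalk u [e, f] v" using assms by (auto simp: awalk_simps)
  moreover have "length [e, f] \<le> length q" if q: "awalk u q v" for q
  proof (rule ccontr)
    assume "\<not> length [e, f] \<le> length q"
    then consider "q = []" | a where "q = [a]" by (cases q; cases "tl q") auto
    then show False
    proof cases
      case 1
      then show ?thesis using q assms(7) by (simp add: awalk_simps)
    next
      case (2 a)
      then have "a \<in> arcs G" "tail G a = u" "head G a = v" using q by (auto simp: awalk_simps)
      then have "u \<rightarrow> v" by (intro dominatesI[of a]) (auto simp: arc_to_ends_def)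
      then show ?thesis using assms(8) by simp
    qed
  qed
  ultimately show ?thesis using unit_distance_eq[of u "[e, f]" v] by simp
qed

end

section \<open>Labelling the non-isolated vertices\<close>

lemma dihedral_dist_cases:
  "dihedral_dist n x y = 0 \<and> x = y \<or> dihedral_dist n x y \<in> {1, 2} \<and> x \<noteq> y"
  by (auto simp: dihedral_dist_def split: sum.split)

lemma dihedral_dist_commute: "dihedral_dist n x y = dihedral_dist n y x"
proof -
  have "coprime (int i - int j) (int n) \<longleftrightarrow> coprime (int j - int i) (int n)" for i j
    using coprime_minus_left_iff[of "int i - int j" "int n"] by simp
  then show ?thesis by (auto simp: dihedral_dist_def split: sum.split)
qed

text \<open>Any enumeration \<open>unit\<close> of the residues prime to \<open>n\<close> will do,
  since the distances do not see which such exponent a rotation carries.\<close>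

locale labelled_dihedral_group = dihedral_group +
  fixes unit :: "nat \<Rightarrow> nat"
  assumes n_ge_2: "n \<ge> 2"
    and units: "bij_betw unit {..<totient n} (totatives n)"
begin

definition vertex :: "nat + nat \<Rightarrow> 'a" where
  "vertex x = (case x of Inl i \<Rightarrow> element (int (unit i)) False | Inr j \<Rightarrow> element (int j) True)"

abbreviation \<Delta> :: "('a, 'a \<times> 'a) pre_digraph" where
  "\<Delta> \<equiv> remove_isolated (generating_graph G)"

lemma n_pos: "n > 0"
  using n_ge_2 by simp

lemma unit_less: "i < totient n \<Longrightarrow> unit i < n"
  using bij_betwE[OF units] n_ge_2 by (simp add: totatives_less)

lemma unit_coprime: "i < totient n \<Longrightarrow> coprime (unit i) n"
  using bij_betwE[OF units] by (simp add: totatives_def)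

lemma inj_vertex: "inj_on vertex (dihedral_labels n)"
proof (rule inj_onI)
  have inj: "inj_on unit {..<totient n}" using units by (simp add: bij_betw_def)
  fix x y assume "x \<in> dihedral_labels n" "y \<in> dihedral_labels n" "vertex x = vertex y"
  then show "x = y"
    by (auto simp: vertex_def dihedral_labels_def element_eq_iff[OF n_pos] unit_less
        intro: inj_onD[OF inj] simp flip: zmod_int)
qed

lemma generate_vertices:
  assumes "x \<in> dihedral_labels n" "y \<in> dihedral_labels n"
  shows "vertex x \<noteq> vertex y \<and> generate G {vertex x, vertex y} = carrier G \<longleftrightarrow> dihedral_dist n x y = 1"
proof -
  have *: "vertex x \<noteq> vertex y \<longleftrightarrow> x \<noteq> y" using inj_vertex assms by (auto simp: inj_on_eq_iff)
  have comm: "generate G {element i True, element j False} = generate G {element j False, element i True}" for i j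
    by (simp only: insert_commute)
  have sw: "coprime (int i - int j) (int n) \<longleftrightarrow> coprime (int j - int i) (int n)" for i j
    using coprime_minus_left_iff[of "int i - int j" "int n"] by simp
  show ?thesis unfolding *
    using assms
    by (cases x; cases y)
      (simp_all add: vertex_def dihedral_dist_def generate_two_rotations[OF n_pos]
        generate_rotation_reflection[OF n_pos] generate_two_reflections[OF n_pos] comm unit_coprime sw)
qed

lemma generator_pair_vertices:
  assumes gh: "g \<in> carrier G" "h \<in> carrier G" and gen: "generate G {g, h} = carrier G"
  shows "g \<in> vertex ` dihedral_labels n"
proof -
  obtain i a where g: "g = element i a" using gh(1) carrier_eq_elements by auto
  obtain j b where h: "h = element j b" using gh(2) carrier_eq_elements by auto
  show ?thesis
  proof (cases a)
    case True
    then have "g = vertex (Inr (nat (i mod int n)))"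
      using n_pos by (simp add: g vertex_def element_mod)
    moreover have "nat (i mod int n) < n" using n_pos by (simp add: nat_less_iff)
    ultimately show ?thesis by (auto simp: dihedral_labels_def)
  next
    case False
    with gen g h have "b" "coprime i (int n)"
      using generate_two_rotations[OF n_pos] generate_rotation_reflection[OF n_pos] by (cases b; simp)+
    define m where "m = nat (i mod int n)"
    have m: "int m = i mod int n" "m < n" using n_pos by (simp_all add: m_def nat_less_iff)
    have "coprime (int m) (int n)" using \<open>coprime i (int n)\<close> n_pos by (simp add: m(1))
    then have cop: "coprime m n" by simp
    \<comment> \<open>\<open>totatives\<close> excludes 0, and 0 is prime to \<open>n\<close> only
      for \<open>n = 1\<close>.\<close>
    have "m \<noteq> 0"
    proof
      assume "m = 0"
      with cop show False using n_ge_2 by simp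
    qed
    with cop m(2) have "m \<in> totatives n" by (simp add: totatives_def)
    then have "m \<in> unit ` {..<totient n}" using units by (simp add: bij_betw_def)
    then obtain k where k: "k < totient n" "unit k = m" by auto
    then have "vertex (Inl k) = g" using False by (simp add: g vertex_def m(1) element_mod)
    with k(1) have "Inl k \<in> dihedral_labels n" "g = vertex (Inl k)" by auto
    then show ?thesis by blast
  qed
qed

lemma exists_neighbour:
  assumes "x \<in> dihedral_labels n"
  obtains y where "y \<in> dihedral_labels n" "dihedral_dist n x y = 1"
proof (cases x)
  case (Inl i)
  then show ?thesis using n_pos by (intro that[of "Inr 0"]) (auto simp: dihedral_labels_def dihedral_dist_def)
next
  case (Inr j)
  then show ?thesis using n_pos by (intro that[of "Inl 0"]) (auto simp: dihedral_labels_def dihedral_dist_def)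
qed

lemma vertex_closed [simp]: "vertex x \<in> carrier G"
  by (simp add: vertex_def split: sum.split)

lemma verts_\<Delta>: "verts \<Delta> = vertex ` dihedral_labels n"
proof
  show "verts \<Delta> \<subseteq> vertex ` dihedral_labels n"
    using generator_pair_vertices
    by (auto simp: remove_isolated_def generating_graph_def in_arcs_def out_arcs_def insert_commute)
next
  show "vertex ` dihedral_labels n \<subseteq> verts \<Delta>"
  proof
    fix v assume "v \<in> vertex ` dihedral_labels n"
    then obtain x where x: "x \<in> dihedral_labels n" "v = vertex x" by blast
    obtain y where "y \<in> dihedral_labels n" "dihedral_dist n x y = 1" using exists_neighbour[OF x(1)] .
    with generate_vertices[OF x(1)] have "(v, vertex y) \<in> out_arcs (generating_graph G) v"
      by (simp add: generating_graph_def x(2))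
    moreover have "v \<in> verts (generating_graph G)" by (simp add: generating_graph_def x(2))
    ultimately show "v \<in> verts \<Delta>" unfolding remove_isolated_def induce_subgraph_verts by blast
  qed
qed

lemma tail_\<Delta> [simp]: "tail \<Delta> = fst" and head_\<Delta> [simp]: "head \<Delta> = snd"
  by (simp_all add: remove_isolated_def generating_graph_def)

lemma arcs_\<Delta>_eq: "arcs \<Delta> = {(g, h). g \<in> verts \<Delta> \<and> h \<in> verts \<Delta> \<and> g \<noteq> h \<and> generate G {g, h} = carrier G}"
proof -
  have "arcs \<Delta> = {e \<in> arcs (generating_graph G). fst e \<in> verts \<Delta> \<and> snd e \<in> verts \<Delta>}"
    by (simp add: remove_isolated_def generating_graph_def)
  moreover have "verts \<Delta> \<subseteq> carrier G" by (auto simp: verts_\<Delta>)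
  ultimately show ?thesis by (auto simp: generating_graph_def)
qed

lemma arc_\<Delta>_iff:
  assumes "x \<in> dihedral_labels n" "y \<in> dihedral_labels n"
  shows "(vertex x, vertex y) \<in> arcs \<Delta> \<longleftrightarrow> dihedral_dist n x y = 1"
  using assms generate_vertices[OF assms] by (auto simp: arcs_\<Delta>_eq verts_\<Delta>)

lemma graph_\<Delta>: "graph \<Delta>"
proof -
  have "finite (verts \<Delta>)" by (simp add: verts_\<Delta>)
  moreover from this have "finite (arcs \<Delta>)"
    by (intro finite_subset[of "arcs \<Delta>" "verts \<Delta> \<times> verts \<Delta>"]) (auto simp: arcs_\<Delta>_eq)
  moreover have "sym (arcs \<Delta>)" by (auto simp: sym_def arcs_\<Delta>_eq insert_commute)
  then have "symmetric \<Delta>" by (simp add: symmetric_def arcs_ends_conv)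
  ultimately show ?thesis
    by unfold_locales (auto simp: arcs_\<Delta>_eq arc_to_ends_def)
qed

lemma distance_\<Delta>:
  assumes x: "x \<in> dihedral_labels n" and y: "y \<in> dihedral_labels n"
  shows "wf_digraph.\<mu> \<Delta> (\<lambda>_. 1) (vertex x) (vertex y) = ereal (dihedral_dist n x y)"
proof -
  interpret D: graph \<Delta> by (rule graph_\<Delta>)
  consider "x = y" | "dihedral_dist n x y = 1" "x \<noteq> y" | "dihedral_dist n x y = 2" "x \<noteq> y"
    using dihedral_dist_cases[of n x y] by auto
  then show ?thesis
  proof cases
    case 1
    then show ?thesis using x D.unit_distance_refl[of "vertex x"]
      by (simp add: verts_\<Delta> dihedral_dist_def zero_ereal_def)
  next
    case 2
    then have "(vertex x, vertex y) \<in> arcs \<Delta>" using arc_\<Delta>_iff[OF x y] by simp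
    then have "D.\<mu> (\<lambda>_. 1) (vertex x) (vertex y) = 1"
      by (rule D.unit_distance_arc) (use 2 inj_vertex x y in \<open>auto simp: inj_on_eq_iff\<close>)
    then show ?thesis using 2 by (simp add: one_ereal_def)
  next
    case 3
    \<comment> \<open>Labels at distance 2 lie in the same class, and any member of the other class
      is a common neighbour.\<close>
    obtain z where z: "z \<in> dihedral_labels n" "dihedral_dist n x z = 1" "dihedral_dist n y z = 1"
    proof (cases x)
      case (Inl i)
      then obtain j where "y = Inl j" using 3 by (cases y) (auto simp: dihedral_dist_def)
      with Inl show ?thesis using n_pos
        by (intro that[of "Inr 0"]) (auto simp: dihedral_labels_def dihedral_dist_def)
    next
      case (Inr i)
      then obtain j where "y = Inr j" using 3 by (cases y) (auto simp: dihedral_dist_def)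
      with Inr show ?thesis using n_pos
        by (intro that[of "Inl 0"]) (auto simp: dihedral_labels_def dihedral_dist_def)
    qed
    have "D.\<mu> (\<lambda>_. 1) (vertex x) (vertex y) = 2"
    proof (rule D.unit_distance_two)
      show "(vertex x, vertex z) \<in> arcs \<Delta>" using arc_\<Delta>_iff[OF x z(1)] z by simp
      show "(vertex z, vertex y) \<in> arcs \<Delta>"
        using arc_\<Delta>_iff[OF z(1) y] z by (simp add: dihedral_dist_commute)
      show "vertex x \<noteq> vertex y" using 3 inj_vertex x y by (auto simp: inj_on_eq_iff)
      show "\<not> vertex x \<rightarrow>\<^bsub>\<Delta>\<^esub> vertex y"
        using arc_\<Delta>_iff[OF x y] 3 by (auto simp: arcs_ends_conv)
    qed auto
    then show ?thesis using 3 by simp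
  qed
qed

lemma connected_\<Delta>: "Digraph_Component.connected \<Delta>"
proof -
  interpret D: graph \<Delta> by (rule graph_\<Delta>)
  show ?thesis
  proof (rule D.connectedI)
    show "verts \<Delta> \<noteq> {}" using n_pos by (auto simp: verts_\<Delta> dihedral_labels_def)
  next
    fix u v assume "u \<in> verts \<Delta>" "v \<in> verts \<Delta>"
    then obtain x y where xy: "x \<in> dihedral_labels n" "y \<in> dihedral_labels n" "u = vertex x" "v = vertex y"
      by (auto simp: verts_\<Delta>)
    \<comment> \<open>An unreachable vertex would be at infinite distance, whereas all distances are
      known to be finite.\<close>
    have "D.\<mu> (\<lambda>_. 1) u v \<noteq> \<infinity>" using distance_\<Delta>[OF xy(1,2)] xy by simp
    then have "u \<rightarrow>\<^sup>*\<^bsub>\<Delta>\<^esub> v" using D.shortest_path_inf by blast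
    then show "u \<rightarrow>\<^sup>*\<^bsub>with_proj (mk_symmetric \<Delta>)\<^esub> v" by (rule D.reachable_mk_symmetricI)
  qed
qed

lemma has_distance_spectrum_\<Delta>:
  "has_distance_spectrum \<Delta> (\<Sum>w\<in>dihedral_labels n. {#dihedral_eigval n w#})"
  unfolding has_distance_spectrum_def
proof (intro conjI allI impI graph_\<Delta> connected_\<Delta>)
  fix vs assume vs: "distinct vs \<and> set vs = verts \<Delta>"
  \<comment> \<open>The labels are listed in the order of \<open>vs\<close>, so the two matrices are
    equal entry by entry and no permutation argument arises.\<close>
  define ls where "ls = map (inv_into (dihedral_labels n) vertex) vs"
  have set_ls: "set ls = dihedral_labels n"
    using vs inj_vertex by (simp add: ls_def verts_\<Delta> image_image)
  have dist_ls: "distinct ls"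
    using vs by (simp add: ls_def distinct_map verts_\<Delta> inj_on_inv_into)
  have nth: "vertex (ls ! i) = vs ! i" "ls ! i \<in> dihedral_labels n" if "i < length vs" for i
  proof -
    have "vs ! i \<in> vertex ` dihedral_labels n" using that vs verts_\<Delta> by (metis nth_mem)
    then show "vertex (ls ! i) = vs ! i" "ls ! i \<in> dihedral_labels n"
      using that by (simp_all add: ls_def f_inv_into_f inv_into_into)
  qed
  have "distance_matrix \<Delta> vs =
    mat (length ls) (length ls) (\<lambda>(i, j). dihedral_dist n (ls ! i) (ls ! j))"
  proof (rule eq_matI)
    fix i j
    assume "i < dim_row (mat (length ls) (length ls) (\<lambda>(i, j). dihedral_dist n (ls ! i) (ls ! j)))"
      "j < dim_col (mat (length ls) (length ls) (\<lambda>(i, j). dihedral_dist n (ls ! i) (ls ! j)))"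
    then have ij: "i < length vs" "j < length vs" by (simp_all add: ls_def)
    have "wf_digraph.\<mu> \<Delta> (\<lambda>_. 1) (vs ! i) (vs ! j) = ereal (dihedral_dist n (ls ! i) (ls ! j))"
      using distance_\<Delta>[OF nth(2)[OF ij(1)] nth(2)[OF ij(2)]] by (simp only: nth(1)[OF ij(1)] nth(1)[OF ij(2)])
    then show "distance_matrix \<Delta> vs $$ (i, j) =
       mat (length ls) (length ls) (\<lambda>(i, j). dihedral_dist n (ls ! i) (ls ! j)) $$ (i, j)"
      using ij by (simp add: distance_matrix_def ls_def)
  qed (simp_all add: distance_matrix_def ls_def)
  then show "proots (char_poly (distance_matrix \<Delta> vs)) = (\<Sum>w\<in>dihedral_labels n. {#dihedral_eigval n w#})"
    using proots_char_poly_dihedral_dist[OF n_ge_2 dist_ls set_ls] by simp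
qed

end

theorem theorem5p2:
  fixes G :: "('a, 'b) monoid_scheme"
    and r s :: 'a
    and n n0 k :: nat
    and d :: "nat \<Rightarrow> nat"
  assumes "n \<ge> 2"
    and "n0 = \<Prod>(prime_factors n)"
    and "k = card (prime_factors n)"
    and "strict_mono_on {1..2 ^ k} d"
    and "d ` {1..2 ^ k} = {m. m dvd n0}"
    and "dihedral_group G n r s"
  shows "has_distance_spectrum (remove_isolated (generating_graph G))
    (replicate_mset (totient n + n - n0 - 1) (- 2)
     + (\<Sum>i = 2..2 ^ k. replicate_mset (totient (d i))
          (- 2 - real_of_int (moebius_mu (d i)) * (real (totient n) / real (totient (d i)))))
     + {# (real n - 2 + real (totient n) / 2)
            + sqrt ((real n)\<^sup>2 + (3 * real (totient n) / 2)\<^sup>2 - 2 * real n * real (totient n)),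
          (real n - 2 + real (totient n) / 2)
            - sqrt ((real n)\<^sup>2 + (3 * real (totient n) / 2)\<^sup>2 - 2 * real n * real (totient n)) #})"
proof -
  have inj: "inj_on d {1..2 ^ k}" using assms(4) by (rule strict_mono_on_imp_inj_on)
  \<comment> \<open>The divisor 1 is attained and \<open>d 1\<close> is the least value, so the
    index range from 2 enumerates exactly the divisors other than 1.\<close>
  have d1: "d 1 = 1"
  proof -
    have "1 \<in> d ` {1..2 ^ k}" using assms(5) by simp
    then obtain i where i: "i \<in> {1..2 ^ k}" "d i = 1" by auto
    have "d 1 dvd n0" using assms(5) by force
    moreover have "n0 > 0" unfolding assms(2) by (auto intro!: prod_pos simp: in_prime_factors_iff prime_gt_0_nat)
    ultimately have "d 1 > 0" by (auto intro: Nat.gr0I)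
    moreover have "d 1 \<le> d i" using strict_mono_on_leD[OF assms(4), of 1 i] i by auto
    ultimately show ?thesis using i(2) by linarith
  qed
  have "{1..2 ^ k} = insert 1 {2..2 ^ k :: nat}" by auto
  then have d: "bij_betw d {2..2 ^ k} ({t. t dvd n0} - {1})"
    using inj d1 assms(5) unfolding bij_betw_def by (auto simp: inj_on_def)
  obtain unit where "bij_betw unit {..<totient n} (totatives n)"
    using ex_bij_betw_nat_finite[of "totatives n"] by (auto simp: totient_def atLeast0LessThan)
  with assms(1,6) interpret labelled_dihedral_group G n r s unit
    by (intro labelled_dihedral_group.intro labelled_dihedral_group_axioms.intro)
  have "(\<Sum>i = 2..2 ^ k. replicate_mset (totient (d i))
          (- 2 - real_of_int (moebius_mu (d i)) * (real (totient n) / real (totient (d i))))) =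
    (\<Sum>t\<in>{t. t dvd n0} - {1}. replicate_mset (totient t)
          (- 2 - real_of_int (moebius_mu t) * (real (totient n) / real (totient t))))"
    by (rule sum.reindex_bij_betw[OF d, of "\<lambda>t. replicate_mset (totient t)
          (- 2 - real_of_int (moebius_mu t) * (real (totient n) / real (totient t)))"])
  then show ?thesis
    using has_distance_spectrum_\<Delta>
    unfolding dihedral_eigval_mset[OF assms(1)] dihedral_disc_def assms(2) by simp
qed

end
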